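(* Let $d,k,n\ge1$ be integers with $d\le kn$, and let $M_1\in\mathcal M_d(\mathbb C)$ be the first effect of a Haar-random POVM of parameters $(d,k;n)$. Then for every integer $p\ge 1$, $$\mathbb E\operatorname{Tr}(M_1^p)=\sum_{\alpha,\beta\in\mathcal S_p} n^{\#\alpha}\,d^{\#(\beta\gamma^{-1})}\,\operatorname{Wg}(kn,\alpha^{-1}\beta),$$ where $\#\sigma$ denotes the number of cycles of a permutation $\sigma$ (fixed points included) and $\gamma=(p,p-1,\ldots,3,2,1)\in\mathcal S_p$ is the full cycle.
   Context: Haar-random POVM of parameters $(d,k;n)$, $d\le kn$: let $\{e_i\}_{i=1}^k$ be a fixed orthonormal basis of $\mathbb C^k$ and $V:\mathbb C^d\to\mathbb C^k\otimes\mathbb C^n$ a Haar-distributed random isometry (equivalently, the first $d$ columns of a Haar-distributed unitary in $\mathcal U(kn)$). The effects are $M_i=V^*(|e_i\rangle\langle e_i|\otimes I_n)V\in\mathcal M_d(\mathbb C)$, $1\le i\le k$. Unitary Weingarten function: for $N\ge1$, $\operatorname{Wg}(N,\cdot):\mathcal S_p\to\mathbb R$ is the inverse of the function $\sigma\mapsto N^{\#\sigma}$ for convolution on $\mathcal S_p$, i.e. $\sum_{\tau\in\mathcal S_p}\operatorname{Wg}(N,\sigma^{-1}\tau)N^{\#(\tau^{-1}\pi)}=\delta_{\sigma,\pi}$ for all $\sigma,\pi\in\mathcal S_p$ (this inverse exists for $p\le N$; for $p>N$ one takes, as usual, the pseudo-inverse in the group algebra). It is the function appearing in the integration formula $$\int_{\mathcal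 U(N)}U_{i_1j_1}\cdots U_{i_pj_p}\overline{U_{i'_1j'_1}}\cdots\overline{U_{i'_pj'_p}}\,dU=\sum_{\alpha,\beta\in\mathcal S_p}\prod_{l=1}^p\delta_{i_l i'_{\alpha(l)}}\delta_{j_l j'_{\beta(l)}}\operatorname{Wg}(N,\alpha^{-1}\beta).$$ *)

theory Defs
  imports "HOL-Probability.Probability" "HOL-Combinatorics.Orbits" "HOL-Combinatorics.Cycles"
begin

section \<open>Complex matrices\<close>

text \<open>A matrix with rows indexed by \<open>'m\<close> and columns by \<open>'n\<close> has type \<open>complex^'n^'m\<close>; the dimensions
  are the cardinalities of the index types. The space \<open>\<complex>\<^sup>k \<otimes> \<complex>\<^sup>n\<close> is the space of vectors indexed by
  pairs, with the product basis vector of \<open>i\<close> and \<open>a\<close> at index \<open>(i, a)\<close>.\<close>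

definition adjoint_mat :: "complex^'n^'m \<Rightarrow> complex^'m^'n" where
  "adjoint_mat A = (\<chi> i j. cnj (A $ j $ i))"

text \<open>The instance of \<open>power\<close> for vectors is componentwise, so powers of matrices need a separate
  definition.\<close>

definition mat_power :: "complex^'n^'n \<Rightarrow> nat \<Rightarrow> complex^'n^'n" where
  "mat_power A p = ((**) A ^^ p) (mat 1)"

definition tensor_mat ::
    "complex^'a^'c \<Rightarrow> complex^'b^'e \<Rightarrow>
      complex^('a::finite \<times> 'b::finite)^('c::finite \<times> 'e::finite)" where
  "tensor_mat A B = (\<chi> r s. A $ fst r $ fst s * B $ snd r $ snd s)"

text \<open>The operator \<open>|v\<rangle>\<langle>v|\<close>.\<close>

definition rank_one :: "complex^'k \<Rightarrow> complex^'k^'k" where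
  "rank_one v = (\<chi> i j. v $ i * cnj (v $ j))"

definition isometry_mat :: "complex^'d^'m \<Rightarrow> bool" where
  "isometry_mat V \<longleftrightarrow> adjoint_mat V ** V = mat 1"

definition unitary_mat :: "complex^'m^'m \<Rightarrow> bool" where
  "unitary_mat U \<longleftrightarrow> adjoint_mat U ** U = mat 1 \<and> U ** adjoint_mat U = mat 1"

text \<open>An orthonormal basis of \<open>\<complex>\<^sup>k\<close>, numbered from \<open>1\<close> to \<open>k\<close>. Spanning follows from the number of
  vectors.\<close>

definition orthonormal_basis :: "(nat \<Rightarrow> complex^'k) \<Rightarrow> bool" where
  "orthonormal_basis e \<longleftrightarrow>
     (\<forall>i\<in>{1..CARD('k)}. \<forall>j\<in>{1..CARD('k)}.
        (\<Sum>l\<in>UNIV. cnj (e i $ l) * e j $ l) = (if i = j then 1 else 0))"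


section \<open>Haar-random POVMs\<close>

text \<open>The Haar law on the isometries \<open>\<complex>\<^sup>d \<rightarrow> \<complex>\<^sup>m\<close> is the unique probability measure on them that is
  invariant under left multiplication by \<open>\<U>(m)\<close>. For \<open>'d = 'm\<close> it is the Haar probability measure of
  the group \<open>\<U>(m)\<close>. The lemma \<open>haar_isometry_columns\<close> below treats truncations of Haar unitaries.\<close>

definition haar_isometry_law :: "(complex^'d^'m) measure \<Rightarrow> bool" where
  "haar_isometry_law \<mu> \<longleftrightarrow>
     prob_space \<mu> \<and> sets \<mu> = sets borel \<and>
     (AE V in \<mu>. isometry_mat V) \<and>
     (\<forall>U. unitary_mat U \<longrightarrow> distr \<mu> borel (\<lambda>V. U ** V) = \<mu>)"

definition haar_isometry :: "'w measure \<Rightarrow> ('w \<Rightarrow> complex^'d^'m) \<Rightarrow> bool" where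
  "haar_isometry P V \<longleftrightarrow> V \<in> borel_measurable P \<and> haar_isometry_law (distr P borel V)"

definition povm_effect ::
    "(nat \<Rightarrow> complex^'k) \<Rightarrow> complex^'d^('k::finite \<times> 'n::finite) \<Rightarrow> nat \<Rightarrow> complex^'d^'d" where
  "povm_effect e V i = adjoint_mat V ** tensor_mat (rank_one (e i)) (mat 1 :: complex^'n^'n) ** V"

lemma haar_isometry_columns:
  fixes \<mu> :: "(complex^'m^'m) measure" and \<iota> :: "'d::finite \<Rightarrow> 'm::finite"
  assumes \<mu>: "haar_isometry_law \<mu>" and \<iota>: "inj \<iota>"
  shows "haar_isometry \<mu> (\<lambda>U. (\<chi> r c. U $ r $ \<iota> c) :: complex^'d^'m)"
proof -
  let ?J = "\<lambda>U. (\<chi> r c. U $ r $ \<iota> c) :: complex^'d^'m"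
  interpret prob_space \<mu> using \<mu> by (simp add: haar_isometry_law_def)
  have sets: "sets \<mu> = sets borel" using \<mu> by (simp add: haar_isometry_law_def)
  have J0: "?J \<in> borel_measurable borel"
    by (intro borel_measurable_continuous_onI continuous_intros)
  then have J: "?J \<in> borel_measurable \<mu>"
    by (simp add: measurable_cong_sets[OF sets refl])
  have mult_m: "(\<lambda>A. W ** A) \<in> borel_measurable borel" for W :: "complex^'m^'m"
    unfolding matrix_matrix_mult_def
    by (intro borel_measurable_continuous_onI continuous_intros)
  have mult_d: "(\<lambda>A::complex^'d^'m. W ** A) \<in> borel_measurable borel" for W :: "complex^'m^'m"
    unfolding matrix_matrix_mult_def
    by (intro borel_measurable_continuous_onI continuous_intros)
  have mult_\<mu>: "(\<lambda>A. W ** A) \<in> borel_measurable \<mu>" for W :: "complex^'m^'m"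
    using mult_m by (simp add: measurable_cong_sets[OF sets refl])
  have "closed {A::complex^'d^'m. isometry_mat A}"
    unfolding isometry_mat_def adjoint_mat_def matrix_matrix_mult_def
    by (intro closed_Collect_eq continuous_intros)
  then have isom_sets: "{A \<in> space borel. isometry_mat (A::complex^'d^'m)} \<in> sets borel"
    by (simp add: borel_closed)
  have "isometry_mat (?J U)" if "isometry_mat U" for U
  proof -
    have "(\<Sum>l\<in>UNIV. cnj (U $ l $ a) * U $ l $ b) = (if a = b then 1 else 0)" for a b
      using that
      by (simp add: isometry_mat_def adjoint_mat_def matrix_matrix_mult_def mat_def vec_eq_iff)
    then show ?thesis
      using \<iota>
      by (simp add: isometry_mat_def adjoint_mat_def matrix_matrix_mult_def mat_def vec_eq_iff
          inj_eq)
  qed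
  then have "AE U in \<mu>. isometry_mat (?J U)"
    using \<mu> by (auto simp: haar_isometry_law_def elim: eventually_mono)
  then have isom: "AE V in distr \<mu> borel ?J. isometry_mat V"
    by (simp add: AE_distr_iff[OF J isom_sets])
  have inv: "distr (distr \<mu> borel ?J) borel (\<lambda>V. W ** V) = distr \<mu> borel ?J"
    if "unitary_mat W" for W
  proof -
    have "distr (distr \<mu> borel ?J) borel (\<lambda>V. W ** V) = distr \<mu> borel (\<lambda>U. W ** ?J U)"
      using distr_distr[OF mult_d J] by (simp add: o_def)
    also have "(\<lambda>U. W ** ?J U) = (\<lambda>U. ?J (W ** U))"
      by (simp add: matrix_matrix_mult_def vec_eq_iff fun_eq_iff)
    also have "distr \<mu> borel (\<lambda>U. ?J (W ** U)) = distr (distr \<mu> borel (\<lambda>U. W ** U)) borel ?J"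
      using distr_distr[OF J0 mult_\<mu>] by (simp add: o_def)
    also have "\<dots> = distr \<mu> borel ?J"
      using \<mu> that by (simp add: haar_isometry_law_def)
    finally show ?thesis .
  qed
  show ?thesis
    using J isom inv prob_space_distr[OF J]
    by (simp add: haar_isometry_def haar_isometry_law_def)
qed


section \<open>Permutations and the Weingarten function\<close>

definition sym_grp :: "nat \<Rightarrow> (nat \<Rightarrow> nat) set" where
  "sym_grp p = {\<sigma>. \<sigma> permutes {1..p}}"

definition num_cycles :: "nat \<Rightarrow> (nat \<Rightarrow> nat) \<Rightarrow> nat" where
  "num_cycles p \<sigma> = card (orbit \<sigma> ` {1..p})"

text \<open>The full cycle \<open>p \<mapsto> p - 1 \<mapsto> \<dots> \<mapsto> 2 \<mapsto> 1 \<mapsto> p\<close>.\<close>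

definition full_cycle :: "nat \<Rightarrow> nat \<Rightarrow> nat" where
  "full_cycle p = cycle_of_list (rev [1..<Suc p])"

text \<open>Elements of the group algebra \<open>\<real>[S\<^sub>p]\<close> are functions vanishing outside \<open>S\<^sub>p\<close>, with convolution
  as product and \<open>f\<^sup>*(\<sigma>) = f(\<sigma>\<^sup>-\<^sup>1)\<close> as involution.\<close>

definition grp_alg :: "nat \<Rightarrow> ((nat \<Rightarrow> nat) \<Rightarrow> real) set" where
  "grp_alg p = {f. \<forall>\<sigma>. \<sigma> \<notin> sym_grp p \<longrightarrow> f \<sigma> = 0}"

definition conv ::
    "nat \<Rightarrow> ((nat \<Rightarrow> nat) \<Rightarrow> real) \<Rightarrow> ((nat \<Rightarrow> nat) \<Rightarrow> real) \<Rightarrow> (nat \<Rightarrow> nat) \<Rightarrow> real" where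
  "conv p f g \<sigma> = (if \<sigma> \<in> sym_grp p then \<Sum>\<tau>\<in>sym_grp p. f \<tau> * g (inv \<tau> \<circ> \<sigma>) else 0)"

definition star :: "nat \<Rightarrow> ((nat \<Rightarrow> nat) \<Rightarrow> real) \<Rightarrow> (nat \<Rightarrow> nat) \<Rightarrow> real" where
  "star p f \<sigma> = (if \<sigma> \<in> sym_grp p then f (inv \<sigma>) else 0)"

definition cycle_weight :: "nat \<Rightarrow> nat \<Rightarrow> (nat \<Rightarrow> nat) \<Rightarrow> real" where
  "cycle_weight N p \<sigma> = (if \<sigma> \<in> sym_grp p then real N ^ num_cycles p \<sigma> else 0)"

text \<open>The Moore--Penrose conditions in the group algebra.\<close>

definition pseudo_inverse ::
    "nat \<Rightarrow> ((nat \<Rightarrow> nat) \<Rightarrow> real) \<Rightarrow> ((nat \<Rightarrow> nat) \<Rightarrow> real) \<Rightarrow> bool" where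
  "pseudo_inverse p f w \<longleftrightarrow>
     w \<in> grp_alg p \<and>
     conv p (conv p f w) f = f \<and> conv p (conv p w f) w = w \<and>
     star p (conv p f w) = conv p f w \<and> star p (conv p w f) = conv p w f"

text \<open>The pseudo-inverse of \<open>\<sigma> \<mapsto> N\<^bsup>#\<sigma>\<^esup>\<close> covers all \<open>p\<close> and \<open>N\<close> at once. It is the inverse whenever
  that exists, as the lemma \<open>Wg_eq_inverse\<close> below shows.\<close>

definition Wg :: "nat \<Rightarrow> nat \<Rightarrow> (nat \<Rightarrow> nat) \<Rightarrow> real" where
  "Wg N p = (THE w. pseudo_inverse p (cycle_weight N p) w)"

lemma sym_grp_simps [simp]:
  assumes "\<sigma> \<in> sym_grp p"
  shows "inv \<sigma> \<in> sym_grp p" "inv (inv \<sigma>) = \<sigma>" "inv \<sigma> \<circ> \<sigma> = id" "\<sigma> \<circ> inv \<sigma> = id"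
    and "\<tau> \<in> sym_grp p \<Longrightarrow> \<sigma> \<circ> \<tau> \<in> sym_grp p"
    and "\<tau> \<in> sym_grp p \<Longrightarrow> inv (\<sigma> \<circ> \<tau>) = inv \<tau> \<circ> inv \<sigma>"
  using assms
  by (auto simp: sym_grp_def permutes_inv permutes_inv_inv permutes_inv_o permutes_compose
      intro: o_inv_distrib permutes_bij)

lemma sym_grp_cancel [simp]:
  assumes "\<sigma> \<in> sym_grp p"
  shows "inv \<sigma> \<circ> (\<sigma> \<circ> \<tau>) = \<tau>" "\<sigma> \<circ> (inv \<sigma> \<circ> \<tau>) = \<tau>"
    "(\<tau> \<circ> \<sigma>) \<circ> inv \<sigma> = \<tau>" "(\<tau> \<circ> inv \<sigma>) \<circ> \<sigma> = \<tau>"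
  using sym_grp_simps(3,4)[OF assms] by (simp_all add: o_assoc) (simp_all flip: o_assoc)

lemma id_sym_grp [simp]: "id \<in> sym_grp p"
  by (simp add: sym_grp_def permutes_id)

lemma finite_sym_grp [simp]: "finite (sym_grp p)"
  by (simp add: sym_grp_def finite_permutations)

lemma conv_assoc: "conv p (conv p f g) h = conv p f (conv p g h)"
proof
  fix \<sigma>
  show "conv p (conv p f g) h \<sigma> = conv p f (conv p g h) \<sigma>"
  proof (cases "\<sigma> \<in> sym_grp p")
    case True
    have inner: "(\<Sum>\<tau>\<in>sym_grp p. f \<rho> * g (inv \<rho> \<circ> \<tau>) * h (inv \<tau> \<circ> \<sigma>))
        = (\<Sum>\<tau>\<in>sym_grp p. f \<rho> * (g \<tau> * h (inv \<tau> \<circ> (inv \<rho> \<circ> \<sigma>))))"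
      if "\<rho> \<in> sym_grp p" for \<rho>
      by (rule sum.reindex_bij_witness[of _ "\<lambda>\<tau>. \<rho> \<circ> \<tau>" "\<lambda>\<tau>. inv \<rho> \<circ> \<tau>"])
        (use that True in \<open>simp_all add: algebra_simps o_assoc[symmetric]
            sym_grp_simps(6)[OF sym_grp_simps(1)[OF that]]\<close>)
    have "conv p (conv p f g) h \<sigma>
        = (\<Sum>\<tau>\<in>sym_grp p. \<Sum>\<rho>\<in>sym_grp p. f \<rho> * g (inv \<rho> \<circ> \<tau>) * h (inv \<tau> \<circ> \<sigma>))"
      using True by (simp add: conv_def sum_distrib_right)
    also have "\<dots> = (\<Sum>\<rho>\<in>sym_grp p. \<Sum>\<tau>\<in>sym_grp p. f \<rho> * g (inv \<rho> \<circ> \<tau>) * h (inv \<tau> \<circ> \<sigma>))"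
      by (rule sum.swap)
    also have "\<dots> = conv p f (conv p g h) \<sigma>"
      using True by (simp add: conv_def inner sum_distrib_left)
    finally show ?thesis .
  qed (simp add: conv_def)
qed

lemma star_conv: "star p (conv p f g) = conv p (star p g) (star p f)"
proof
  fix \<sigma>
  show "star p (conv p f g) \<sigma> = conv p (star p g) (star p f) \<sigma>"
  proof (cases "\<sigma> \<in> sym_grp p")
    case True
    have "(\<Sum>\<tau>\<in>sym_grp p. f \<tau> * g (inv \<tau> \<circ> inv \<sigma>))
        = (\<Sum>\<tau>\<in>sym_grp p. star p g \<tau> * star p f (inv \<tau> \<circ> \<sigma>))"
      by (rule sum.reindex_bij_witness[of _ "\<lambda>\<tau>. inv \<sigma> \<circ> \<tau>" "\<lambda>\<tau>. \<sigma> \<circ> \<tau>"])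
        (use True in \<open>simp_all add: star_def o_assoc[symmetric]\<close>)
    then show ?thesis using True by (simp add: conv_def star_def)
  qed (simp add: conv_def star_def)
qed

lemma star_star: "f \<in> grp_alg p \<Longrightarrow> star p (star p f) = f"
  by (auto simp: star_def grp_alg_def)

definition grp_one :: "(nat \<Rightarrow> nat) \<Rightarrow> real" where
  "grp_one \<sigma> = (if \<sigma> = id then 1 else 0)"

lemma conv_grp_one:
  assumes "f \<in> grp_alg p"
  shows "conv p grp_one f = f" "conv p f grp_one = f"
proof -
  have eq: "inv \<tau> \<circ> \<sigma> = id \<longleftrightarrow> \<tau> = \<sigma>" if "\<tau> \<in> sym_grp p" "\<sigma> \<in> sym_grp p" for \<tau> \<sigma>
    using that by (metis comp_id sym_grp_cancel(2) sym_grp_simps(3))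
  show "conv p grp_one f = f"
  proof
    fix \<sigma>
    show "conv p grp_one f \<sigma> = f \<sigma>"
    proof (cases "\<sigma> \<in> sym_grp p")
      case True
      have "(if \<tau> = id then 1 else 0) * f (inv \<tau> \<circ> \<sigma>) = (if \<tau> = id then f \<sigma> else 0)" for \<tau>
        by simp
      then have "conv p grp_one f \<sigma> = (\<Sum>\<tau>\<in>sym_grp p. if \<tau> = id then f \<sigma> else 0)"
        using True by (simp only: conv_def grp_one_def if_True)
      then show ?thesis by simp
    qed (use assms in \<open>simp add: conv_def grp_alg_def\<close>)
  qed
  show "conv p f grp_one = f"
  proof
    fix \<sigma>
    show "conv p f grp_one \<sigma> = f \<sigma>"
    proof (cases "\<sigma> \<in> sym_grp p")
      case True
      have "f \<tau> * (if inv \<tau> \<circ> \<sigma> = id then 1 else 0) = (if \<tau> = \<sigma> then f \<tau> else 0)"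
        if "\<tau> \<in> sym_grp p" for \<tau>
        using eq[OF that True] by simp
      then have "conv p f grp_one \<sigma> = (\<Sum>\<tau>\<in>sym_grp p. if \<tau> = \<sigma> then f \<tau> else 0)"
        using True by (simp only: conv_def grp_one_def if_True cong: sum.cong)
      then show ?thesis using True by simp
    qed (use assms in \<open>simp add: conv_def grp_alg_def\<close>)
  qed
qed

lemma pseudo_inverse_unique:
  assumes v: "pseudo_inverse p f v" and w: "pseudo_inverse p f w"
  shows "v = w"
proof -
  note a = conv_assoc
  have "conv p f v = conv p f w"
  proof -
    have "conv p f v = star p (conv p (conv p f w) (conv p f v))"
      using v w by (metis a pseudo_inverse_def)
    also have "\<dots> = conv p (conv p f v) (conv p f w)"
      using v w by (simp add: star_conv[of p "conv p f w"] pseudo_inverse_def)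
    also have "\<dots> = conv p f w" using v by (metis a pseudo_inverse_def)
    finally show ?thesis .
  qed
  moreover have "conv p v f = conv p w f"
  proof -
    have "conv p v f = star p (conv p (conv p v f) (conv p w f))"
      using v w by (metis a pseudo_inverse_def)
    also have "\<dots> = conv p (conv p w f) (conv p v f)"
      using v w by (simp add: star_conv[of p "conv p v f"] pseudo_inverse_def)
    also have "\<dots> = conv p w f" using v by (metis a pseudo_inverse_def)
    finally show ?thesis .
  qed
  ultimately show ?thesis using v w by (metis a pseudo_inverse_def)
qed

lemma num_cycles_inv: "\<sigma> \<in> sym_grp p \<Longrightarrow> num_cycles p (inv \<sigma>) = num_cycles p \<sigma>"
  by (simp add: num_cycles_def sym_grp_def orbit_inv_eq
      permutes_imp_permutation[OF finite_atLeastAtMost])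

lemma Wg_eq_inverse:
  assumes w: "w \<in> grp_alg p"
    and inverse: "\<And>\<sigma> \<pi>. \<sigma> \<in> sym_grp p \<Longrightarrow> \<pi> \<in> sym_grp p \<Longrightarrow>
      (\<Sum>\<tau>\<in>sym_grp p. w (inv \<sigma> \<circ> \<tau>) * real N ^ num_cycles p (inv \<tau> \<circ> \<pi>))
        = (if \<sigma> = \<pi> then 1 else 0)"
  shows "Wg N p = w"
proof -
  let ?G = "cycle_weight N p"
  have G: "?G \<in> grp_alg p" by (simp add: cycle_weight_def grp_alg_def)
  have G_star: "star p ?G = ?G"
    by (auto simp: star_def cycle_weight_def num_cycles_inv)
  have wG: "conv p w ?G = grp_one"
  proof
    fix \<pi> show "conv p w ?G \<pi> = grp_one \<pi>"
      using inverse[of id \<pi>] by (auto simp: conv_def cycle_weight_def grp_one_def)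
  qed
  have one: "star p grp_one = grp_one"
  proof
    fix \<sigma>
    show "star p grp_one \<sigma> = grp_one \<sigma>"
    proof (cases "\<sigma> \<in> sym_grp p")
      case True
      then have "inv \<sigma> = id \<longleftrightarrow> \<sigma> = id" by (metis inv_id sym_grp_simps(2))
      then show ?thesis using True by (simp add: star_def grp_one_def)
    qed (auto simp: star_def grp_one_def)
  qed
  have "star p w \<in> grp_alg p" by (simp add: star_def grp_alg_def)
  moreover have G_star_w: "conv p ?G (star p w) = grp_one"
    using star_conv[of p w ?G] wG one G_star by simp
  ultimately have "star p w = w"
    using conv_assoc[of p w ?G "star p w"] wG w by (simp add: conv_grp_one)
  then have Gw: "conv p ?G w = grp_one" using G_star_w by simp
  have "pseudo_inverse p ?G w"
    using w G by (simp add: pseudo_inverse_def wG Gw one conv_grp_one)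
  then show ?thesis
    unfolding Wg_def by (blast intro: the_equality pseudo_inverse_unique)
qed

end

theory Submission
  imports Defs
begin

text \<open>Write \<open>N = kn\<close>, \<open>A = |e\<^sub>1\<rangle>\<langle>e\<^sub>1| \<otimes> I\<^sub>n\<close>, and \<open>P\<^sub>\<sigma>\<close> for the operator permuting tensor factors. Then
  \<open>Tr(M\<^sub>1\<^sup>p)\<close> is the pairing of \<open>A\<^bsup>\<otimes>p\<^esup>\<close> with \<open>V\<^bsup>\<otimes>p\<^esup> P (V\<^sup>*)\<^bsup>\<otimes>p\<^esup>\<close>, where \<open>P\<close> is the cyclic permutation operator.
  By left invariance the expectation \<open>B\<close> of the latter commutes with all \<open>U\<^bsup>\<otimes>p\<^esup>\<close>, \<open>U\<close> unitary, hence by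
  polynomial continuation with \<open>X\<^bsup>\<otimes>p\<^esup>\<close> for sums \<open>X\<close> of matrix units, and by polarization with all
  symmetrized matrix units. An operator with this property that is orthogonal to every \<open>P\<^sub>\<sigma>\<close> vanishes,
  so \<open>B\<close> is the combination of the \<open>P\<^sub>\<sigma>\<close> with the same traces \<open>Tr(B P\<^sub>\<tau>\<^sup>-\<^sup>1) = d\<^bsup>#(\<tau>\<gamma>\<^sup>-\<^sup>1)\<^esup>\<close>; the pseudo-inverse of
  the Gram matrix, i.e. the Weingarten function, gives its coefficients. Pairing with \<open>A\<^bsup>\<otimes>p\<^esup>\<close> contributes
  \<open>n\<^bsup>#\<sigma>\<^esup>\<close>.\<close>


section \<open>Pseudo-inverses in the group algebra\<close>

text \<open>Gram-Schmidt by induction on \<open>S\<close>: the new vector \<open>v s\<close> is made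
  orthogonal to the earlier ones, then the residual is corrected along what remains. This tolerates
  linearly dependent vectors, such as translates of a non-invertible group algebra element.\<close>

lemma least_squares:
  fixes v :: "'s \<Rightarrow> 'a \<Rightarrow> real"
  assumes "finite S" "finite A"
  shows "\<exists>c. \<forall>\<tau>\<in>S. (\<Sum>a\<in>A. v \<tau> a * (t a - (\<Sum>\<sigma>\<in>S. c \<sigma> * v \<sigma> a))) = 0"
  using assms(1)
proof (induction S arbitrary: t rule: finite_induct)
  case (insert s S)
  obtain c where c: "\<forall>\<tau>\<in>S. (\<Sum>a\<in>A. v \<tau> a * (t a - (\<Sum>\<sigma>\<in>S. c \<sigma> * v \<sigma> a))) = 0"
    using insert.IH by blast
  obtain d where d: "\<forall>\<tau>\<in>S. (\<Sum>a\<in>A. v \<tau> a * (v s a - (\<Sum>\<sigma>\<in>S. d \<sigma> * v \<sigma> a))) = 0"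
    using insert.IH by blast
  define r where "r a = t a - (\<Sum>\<sigma>\<in>S. c \<sigma> * v \<sigma> a)" for a
  define u where "u a = v s a - (\<Sum>\<sigma>\<in>S. d \<sigma> * v \<sigma> a)" for a
  have r: "(\<Sum>a\<in>A. v \<tau> a * r a) = 0" and u: "(\<Sum>a\<in>A. v \<tau> a * u a) = 0" if "\<tau> \<in> S" for \<tau>
    using c d that by (auto simp: r_def u_def)
  \<comment> \<open>\<open>v s\<close> and \<open>u\<close> differ by a combination of the earlier
    vectors, so they pair equally with anything orthogonal to those.\<close>
  have vs: "(\<Sum>a\<in>A. v s a * g a) = (\<Sum>a\<in>A. u a * g a)"
    if "\<And>\<tau>. \<tau> \<in> S \<Longrightarrow> (\<Sum>a\<in>A. v \<tau> a * g a) = 0" for g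
  proof -
    have "(\<Sum>a\<in>A. v s a * g a) = (\<Sum>a\<in>A. u a * g a + (\<Sum>\<sigma>\<in>S. d \<sigma> * (v \<sigma> a * g a)))"
      by (intro sum.cong) (auto simp: u_def algebra_simps sum_distrib_left)
    also have "\<dots> = (\<Sum>a\<in>A. u a * g a) + (\<Sum>\<sigma>\<in>S. d \<sigma> * (\<Sum>a\<in>A. v \<sigma> a * g a))"
      unfolding sum.distrib sum_distrib_left by (subst (2) sum.swap) simp
    also have "\<dots> = (\<Sum>a\<in>A. u a * g a)" using that by simp
    finally show ?thesis .
  qed
  \<comment> \<open>The projection coefficient of \<open>r\<close> on \<open>u\<close>. If the
    denominator is 0, then \<open>u\<close> vanishes on \<open>A\<close> and the default value 0 of
    the division does no harm.\<close>
  define k where "k = (\<Sum>a\<in>A. u a * r a) / (\<Sum>a\<in>A. u a * u a)"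
  have k: "k * (\<Sum>a\<in>A. u a * u a) = (\<Sum>a\<in>A. u a * r a)"
  proof (cases "(\<Sum>a\<in>A. u a * u a) = 0")
    case True
    then have "\<forall>a\<in>A. u a = 0"
      using assms(2) by (simp add: sum_nonneg_eq_0_iff)
    then show ?thesis using True by simp
  qed (simp add: k_def)
  define e where "e \<sigma> = (if \<sigma> = s then k else c \<sigma> - k * d \<sigma>)" for \<sigma>
  have e: "t a - (\<Sum>\<sigma>\<in>insert s S. e \<sigma> * v \<sigma> a) = r a - k * u a" for a
  proof -
    have "(\<Sum>\<sigma>\<in>insert s S. e \<sigma> * v \<sigma> a) = k * v s a + (\<Sum>\<sigma>\<in>S. (c \<sigma> - k * d \<sigma>) * v \<sigma> a)"
      using insert.hyps by (auto simp: e_def intro!: sum.cong)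
    then show ?thesis
      by (simp add: r_def u_def algebra_simps sum_subtractf sum_distrib_left)
  qed
  have "(\<Sum>a\<in>A. v \<tau> a * (r a - k * u a)) = 0" if "\<tau> \<in> insert s S" for \<tau>
  proof -
    have split: "(\<Sum>a\<in>A. v \<tau> a * (r a - k * u a))
        = (\<Sum>a\<in>A. v \<tau> a * r a) - k * (\<Sum>a\<in>A. v \<tau> a * u a)" for \<tau>
      by (simp add: algebra_simps sum_subtractf sum_distrib_left)
    show ?thesis
      using that r u vs[of r] vs[of u] k by (auto simp: split)
  qed
  then show ?case using e by (intro exI[of _ e]) simp
qed simp

lemma conv_in_grp_alg [simp]: "conv p f g \<in> grp_alg p"
  by (simp add: conv_def grp_alg_def)

lemma star_in_grp_alg [simp]: "star p f \<in> grp_alg p"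
  by (simp add: star_def grp_alg_def)

lemma conv_diff_left: "conv p (\<lambda>\<sigma>. f \<sigma> - g \<sigma>) h = (\<lambda>\<sigma>. conv p f h \<sigma> - conv p g h \<sigma>)"
  by (auto simp: conv_def algebra_simps sum_subtractf)

lemma conv_zero_left: "conv p (\<lambda>_. 0) g = (\<lambda>_. 0)"
  by (simp add: conv_def fun_eq_iff)

lemma conv_diff_right: "conv p h (\<lambda>\<sigma>. f \<sigma> - g \<sigma>) = (\<lambda>\<sigma>. conv p h f \<sigma> - conv p h g \<sigma>)"
  by (auto simp: conv_def algebra_simps sum_subtractf)

lemma star_diff: "star p (\<lambda>\<sigma>. f \<sigma> - g \<sigma>) = (\<lambda>\<sigma>. star p f \<sigma> - star p g \<sigma>)"
  by (auto simp: star_def)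

lemma conv_star_id: "conv p f (star p f) id = (\<Sum>\<sigma>\<in>sym_grp p. (f \<sigma>)\<^sup>2)"
  by (simp add: conv_def star_def power2_eq_square)

text \<open>For y = r f, self-adjointness makes the product of y with its star equal to r f f times
  the star of r, which is 0. Its value at \<open>id\<close> is the sum of the squares of y, so y =
  0.\<close>

lemma self_adjoint_square_cancel:
  assumes f: "star p f = f" and r: "conv p (conv p r f) f = (\<lambda>_. 0)"
  shows "conv p r f = (\<lambda>_. 0)"
proof -
  let ?y = "conv p r f"
  have "conv p ?y (star p ?y) = conv p (conv p ?y f) (star p r)"
    by (simp add: star_conv f conv_assoc)
  then have "conv p ?y (star p ?y) id = 0"
    unfolding r by (simp add: conv_def)
  then have "\<forall>\<sigma>\<in>sym_grp p. ?y \<sigma> = 0"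
    by (simp add: conv_star_id sum_nonneg_eq_0_iff)
  then show ?thesis
    by (auto simp: conv_def fun_eq_iff)
qed

text \<open>Since \<open>f\<^sup>* = f\<close> forces \<open>r f f = 0 \<Longrightarrow> r f = 0\<close>, the least squares solution of \<open>f = x f f\<close> is exact;
  the pseudo-inverse is then \<open>x f x\<^sup>*\<close>.\<close>

lemma pseudo_inverse_exists:
  assumes f: "f \<in> grp_alg p" "star p f = f"
  shows "\<exists>w. pseudo_inverse p f w \<and> conv p w f = conv p f w \<and> star p w = w"
proof -
  let ?h = "conv p f f"
  have h: "star p ?h = ?h" by (simp add: star_conv f)
  obtain c where c: "\<forall>\<tau>\<in>sym_grp p. (\<Sum>a\<in>sym_grp p. ?h (inv \<tau> \<circ> a) *
      (f a - (\<Sum>\<sigma>\<in>sym_grp p. c \<sigma> * ?h (inv \<sigma> \<circ> a)))) = 0"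
    using least_squares[of "sym_grp p" "sym_grp p" "\<lambda>\<sigma> a. ?h (inv \<sigma> \<circ> a)" f] by auto
  define x where "x \<sigma> = (if \<sigma> \<in> sym_grp p then c \<sigma> else 0)" for \<sigma>
  have x: "x \<in> grp_alg p" by (simp add: x_def grp_alg_def)
  \<comment> \<open>Then y f is the residual f - x f f. As \<open>?h\<close> is self-adjoint,
    orthogonality of the residual to the translates of \<open>?h\<close> becomes y f
    \<open>?h\<close> = 0.\<close>
  define y where "y \<sigma> = grp_one \<sigma> - conv p x f \<sigma>" for \<sigma>
  have yf: "conv p y f = (\<lambda>\<sigma>. f \<sigma> - conv p x ?h \<sigma>)"
    by (simp add: y_def[abs_def] conv_diff_left conv_grp_one f conv_assoc)
  have "conv p (conv p y f) ?h = (\<lambda>_. 0)"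
  proof
    fix \<tau>
    have hinv: "?h (inv a \<circ> \<tau>) = ?h (inv \<tau> \<circ> a)" if "a \<in> sym_grp p" "\<tau> \<in> sym_grp p" for a
      using fun_cong[OF h, of "inv a \<circ> \<tau>"] that
      by (simp add: star_def sym_grp_simps(6)[OF sym_grp_simps(1)])
    have "(\<Sum>a\<in>sym_grp p. ?h (inv \<tau> \<circ> a) * (f a - conv p x ?h a)) = 0" if "\<tau> \<in> sym_grp p"
      using c that by (simp add: conv_def[of p x] x_def)
    then show "conv p (conv p y f) ?h \<tau> = 0"
      unfolding yf conv_def[of p _ ?h] using hinv by (simp add: mult.commute conv_def[of p x])
  qed
  \<comment> \<open>Two cancellations of a factor \<open>f\<close>, from y f f f = 0 to y f =
    0.\<close>
  then have "conv p y f = (\<lambda>_. 0)"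
    by (metis conv_assoc self_adjoint_square_cancel f(2))
  then have xff: "conv p x (conv p f f) = f"
    unfolding yf by (auto simp: fun_eq_iff)
  have ffx: "conv p (conv p f f) (star p x) = f"
    by (metis xff star_conv f(2))
  \<comment> \<open>Both sides equal x f f times the star of x. So x f is self-adjoint; it is the
    projection that \<open>w f\<close> and \<open>f w\<close> turn out to be.\<close>
  have e: "conv p f (star p x) = conv p x f"
    by (metis conv_assoc xff ffx)
  have x2: "star p (star p x) = x" using x by (rule star_star)
  define w where "w = conv p x (conv p f (star p x))"
  have w: "star p w = w" by (simp add: w_def star_conv f x2 conv_assoc)
  have wf: "conv p w f = conv p x f"
    unfolding w_def e by (simp add: conv_assoc xff)
  have fw: "conv p f w = conv p x f"
    by (metis e wf star_conv f(2) w)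
  have "conv p (conv p x f) w = w"
  proof -
    have "w = conv p (conv p x f) (star p x)" by (simp add: w_def conv_assoc)
    moreover have "conv p (conv p x f) (conv p x f) = conv p x f"
      by (metis conv_assoc xff e)
    ultimately show ?thesis by (metis conv_assoc)
  qed
  then have "pseudo_inverse p f w"
    unfolding pseudo_inverse_def using wf fw xff e
    by (simp add: w_def conv_assoc star_conv f x2)
  then show ?thesis using wf fw w by auto
qed

lemma star_cycle_weight: "star p (cycle_weight N p) = cycle_weight N p"
  by (auto simp: star_def cycle_weight_def num_cycles_inv)

text \<open>Existence and uniqueness together give meaning to the definite description in
  \<open>Wg\<close>; commutation and symmetry are inherited from the witness.\<close>

lemma Wg_pseudo_inverse:
  shows "pseudo_inverse p (cycle_weight N p) (Wg N p)"
    and Wg_commute: "conv p (Wg N p) (cycle_weight N p) = conv p (cycle_weight N p) (Wg N p)"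
    and star_Wg: "star p (Wg N p) = Wg N p"
proof -
  let ?G = "cycle_weight N p"
  have "?G \<in> grp_alg p" by (simp add: cycle_weight_def grp_alg_def)
  then obtain w where w: "pseudo_inverse p ?G w" "conv p w ?G = conv p ?G w" "star p w = w"
    using pseudo_inverse_exists star_cycle_weight by blast
  moreover have "Wg N p = w"
    unfolding Wg_def using w(1) by (blast intro: the_equality pseudo_inverse_unique)
  ultimately show "pseudo_inverse p ?G (Wg N p)"
    "conv p (Wg N p) ?G = conv p ?G (Wg N p)" "star p (Wg N p) = Wg N p" by auto
qed


section \<open>Permutations acting on tuples\<close>

text \<open>Extensionality makes equality of tuples the same as agreement on \<open>{1..p}\<close>,
  and permutations of \<open>{1..p}\<close> act by composition because they fix all other
  points.\<close>

definition tuples :: "nat \<Rightarrow> (nat \<Rightarrow> 'a) set" where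
  "tuples p = PiE {1..p} (\<lambda>_. UNIV)"

lemma finite_tuples [simp]: "finite (tuples p :: (nat \<Rightarrow> 'a::finite) set)"
  by (simp add: tuples_def finite_PiE)

lemma tuples_comp [simp]: "K \<in> tuples p \<Longrightarrow> \<sigma> \<in> sym_grp p \<Longrightarrow> K \<circ> \<sigma> \<in> tuples p"
  by (auto simp: tuples_def sym_grp_def PiE_def extensional_def permutes_in_image permutes_not_in)

lemma tuples_eqI: "K \<in> tuples p \<Longrightarrow> L \<in> tuples p \<Longrightarrow> (\<And>l. l \<in> {1..p} \<Longrightarrow> K l = L l) \<Longrightarrow> K = L"
  unfolding tuples_def by (rule PiE_ext) auto

lemma comp_sym_grp_cancel [simp]:
  assumes "\<sigma> \<in> sym_grp p"
  shows "(K \<circ> \<sigma>) \<circ> inv \<sigma> = K" "(K \<circ> inv \<sigma>) \<circ> \<sigma> = K"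
  using assms by (simp_all add: o_assoc[symmetric])

lemma tuples_eq_iff: "K \<in> tuples p \<Longrightarrow> L \<in> tuples p \<Longrightarrow> (\<forall>l\<in>{1..p}. K l = L l) \<longleftrightarrow> K = L"
  using tuples_eqI by blast

lemma sum_tuples_comp:
  assumes "\<sigma> \<in> sym_grp p"
  shows "(\<Sum>K\<in>tuples p. f (K \<circ> \<sigma>)) = (\<Sum>K\<in>tuples p. f K)"
  by (rule sum.reindex_bij_witness[of _ "\<lambda>K. K \<circ> inv \<sigma>" "\<lambda>K. K \<circ> \<sigma>"])
    (use assms in auto)

lemma comp_eq_comp_iff:
  assumes "\<sigma> \<in> sym_grp p" "\<tau> \<in> sym_grp p"
  shows "K \<circ> \<sigma> = L \<circ> \<tau> \<longleftrightarrow> K \<circ> (\<sigma> \<circ> inv \<tau>) = L"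
proof
  assume "K \<circ> \<sigma> = L \<circ> \<tau>"
  then have "K \<circ> \<sigma> \<circ> inv \<tau> = L \<circ> \<tau> \<circ> inv \<tau>" by simp
  then show "K \<circ> (\<sigma> \<circ> inv \<tau>) = L" using assms by (simp add: o_assoc[symmetric])
qed (use assms in \<open>auto simp: o_assoc[symmetric]\<close>)

lemma prod_sym_grp:
  assumes "\<sigma> \<in> sym_grp p"
  shows "(\<Prod>l\<in>{1..p}. f (\<sigma> l)) = (\<Prod>l\<in>{1..p}. f l)"
  using prod.permute[of \<sigma> "{1..p}" f] assms by (simp add: sym_grp_def o_def)

text \<open>Invariance under \<pi> means being constant on each cycle, so a fixed tuple amounts to a
  free choice of one value per cycle.\<close>

lemma card_fixed_tuples:
  fixes \<pi> :: "nat \<Rightarrow> nat"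
  assumes \<pi>: "\<pi> \<in> sym_grp p"
  shows "card {I \<in> tuples p. I \<circ> \<pi> = (I :: nat \<Rightarrow> 'a::finite)} = CARD('a) ^ num_cycles p \<pi>"
proof -
  let ?O = "orbit \<pi> ` {1..p}"
  let ?F = "\<lambda>g::nat set \<Rightarrow> 'a. \<lambda>l\<in>{1..p}. g (orbit \<pi> l)"
  have perm: "\<pi> permutes {1..p}" using \<pi> by (simp add: sym_grp_def)
  then have permutation: "permutation \<pi>"
    by (rule permutes_imp_permutation[OF finite_atLeastAtMost])
  have "bij_betw ?F (PiE ?O (\<lambda>_. UNIV)) {I \<in> tuples p. I \<circ> \<pi> = I}"
    unfolding bij_betw_def
  proof
    show "inj_on ?F (PiE ?O (\<lambda>_. UNIV))"
    proof (rule inj_onI)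
      fix g h :: "nat set \<Rightarrow> 'a" assume g: "g \<in> PiE ?O (\<lambda>_. UNIV)" and h: "h \<in> PiE ?O (\<lambda>_. UNIV)"
        and eq: "?F g = ?F h"
      show "g = h"
      proof (rule PiE_ext[OF g h])
        fix x assume "x \<in> ?O"
        then obtain l where "l \<in> {1..p}" "x = orbit \<pi> l" by blast
        then show "g x = h x" using fun_cong[OF eq, of l] by simp
      qed
    qed
    show "?F ` PiE ?O (\<lambda>_. UNIV) = {I \<in> tuples p. I \<circ> \<pi> = I}"
    proof (intro set_eqI iffI)
      fix I assume "I \<in> ?F ` PiE ?O (\<lambda>_. UNIV)"
      then obtain g where I: "I = ?F g" by blast
      have "I (\<pi> l) = I l" for l
        using permutation_orbit_step[OF permutation, of l] permutes_in_image[OF perm, of l]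
        by (simp only: I restrict_apply)
      then show "I \<in> {I \<in> tuples p. I \<circ> \<pi> = I}"
        by (auto simp: I tuples_def o_def)
    next
      fix I :: "nat \<Rightarrow> 'a" assume I: "I \<in> {I \<in> tuples p. I \<circ> \<pi> = I}"
      then have step: "I (\<pi> l) = I l" for l by (metis (mono_tags) comp_apply mem_Collect_eq)
      have const: "I y = I x" if "y \<in> orbit \<pi> x" for x y
        using that by induction (simp_all add: step)
      define g where "g = (\<lambda>x\<in>?O. I (SOME l. l \<in> x))"
      have "I l = ?F g l" if "l \<in> {1..p}" for l
      proof -
        have "(SOME m. m \<in> orbit \<pi> l) \<in> orbit \<pi> l"
          using permutation_self_in_orbit[OF permutation, of l] by (rule someI)
        then show ?thesis using that const by (simp add: g_def)
      qed
      then have "I = ?F g"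
        using I by (intro tuples_eqI[of _ p]) (auto simp: tuples_def)
      moreover have "g \<in> PiE ?O (\<lambda>_. UNIV)" by (auto simp: g_def)
      ultimately show "I \<in> ?F ` PiE ?O (\<lambda>_. UNIV)" by blast
    qed
  qed
  then have "card {I \<in> tuples p. I \<circ> \<pi> = (I :: nat \<Rightarrow> 'a)} = card (PiE ?O (\<lambda>_. UNIV :: 'a set))"
    by (rule bij_betw_same_card[symmetric])
  also have "\<dots> = CARD('a) ^ num_cycles p \<pi>"
    by (simp add: card_PiE num_cycles_def)
  finally show ?thesis .
qed

text \<open>Two-coloured tuples count cycles: the fixed tuples of \<open>\<sigma> \<circ> \<tau>\<close> and \<open>\<tau> \<circ> \<sigma>\<close> correspond under \<open>I \<mapsto> I \<circ> \<sigma>\<close>.\<close>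

lemma num_cycles_comp_commute:
  assumes "\<sigma> \<in> sym_grp p" "\<tau> \<in> sym_grp p"
  shows "num_cycles p (\<sigma> \<circ> \<tau>) = num_cycles p (\<tau> \<circ> \<sigma>)"
proof -
  have "bij_betw (\<lambda>I. I \<circ> \<sigma>) {I \<in> tuples p. I \<circ> (\<sigma> \<circ> \<tau>) = (I :: nat \<Rightarrow> bool)}
      {I \<in> tuples p. I \<circ> (\<tau> \<circ> \<sigma>) = I}"
  proof (rule bij_betw_byWitness[where f' = "\<lambda>I. I \<circ> inv \<sigma>"])
    show "\<forall>I\<in>{I \<in> tuples p. I \<circ> (\<sigma> \<circ> \<tau>) = (I :: nat \<Rightarrow> bool)}. I \<circ> \<sigma> \<circ> inv \<sigma> = I"
      "\<forall>I\<in>{I \<in> tuples p. I \<circ> (\<tau> \<circ> \<sigma>) = (I :: nat \<Rightarrow> bool)}. I \<circ> inv \<sigma> \<circ> \<sigma> = I"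
      using assms by simp_all
    show "(\<lambda>I. I \<circ> \<sigma>) ` {I \<in> tuples p. I \<circ> (\<sigma> \<circ> \<tau>) = (I :: nat \<Rightarrow> bool)}
      \<subseteq> {I \<in> tuples p. I \<circ> (\<tau> \<circ> \<sigma>) = I}"
      using assms by (auto simp: o_assoc)
    show "(\<lambda>I. I \<circ> inv \<sigma>) ` {I \<in> tuples p. I \<circ> (\<tau> \<circ> \<sigma>) = (I :: nat \<Rightarrow> bool)}
      \<subseteq> {I \<in> tuples p. I \<circ> (\<sigma> \<circ> \<tau>) = I}"
    proof safe
      fix I :: "nat \<Rightarrow> bool" assume "I \<in> tuples p" and eq: "I \<circ> (\<tau> \<circ> \<sigma>) = I"
      then show "I \<circ> inv \<sigma> \<in> tuples p" using assms by simp
      have "I \<circ> inv \<sigma> \<circ> (\<sigma> \<circ> \<tau>) = I \<circ> \<tau>"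
        using assms by (simp add: o_assoc[symmetric])
      also have "\<dots> = I \<circ> (\<tau> \<circ> \<sigma>) \<circ> inv \<sigma>"
        using assms by (simp add: o_assoc[symmetric])
      finally show "I \<circ> inv \<sigma> \<circ> (\<sigma> \<circ> \<tau>) = I \<circ> inv \<sigma>" by (simp only: eq)
    qed
  qed
  then have "(2::nat) ^ num_cycles p (\<sigma> \<circ> \<tau>) = 2 ^ num_cycles p (\<tau> \<circ> \<sigma>)"
    using card_fixed_tuples[where 'a = bool, of "\<sigma> \<circ> \<tau>" p]
      card_fixed_tuples[where 'a = bool, of "\<tau> \<circ> \<sigma>" p] assms
    by (simp add: bij_betw_same_card)
  then show ?thesis by simp
qed

text \<open>Reconciles the Gram entries as they occur in \<open>conv\<close> with the form that
  comes out of traces of permutation operators.\<close>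

lemma num_cycles_inv_comp:
  assumes "\<sigma> \<in> sym_grp p" "\<tau> \<in> sym_grp p"
  shows "num_cycles p (inv \<sigma> \<circ> \<tau>) = num_cycles p (\<sigma> \<circ> inv \<tau>)"
  using num_cycles_inv[of "\<tau> \<circ> inv \<sigma>" p] num_cycles_comp_commute[of "inv \<sigma>" p \<tau>] assms
  by (simp add: sym_grp_simps(6)[OF _ sym_grp_simps(1)])

text \<open>The sum is the trace of a product of two permutation operators, hence an entry of their
  Gram matrix; it counts the tuples fixed by the quotient of the permutations.\<close>

lemma sum_of_bool_comp_eq:
  assumes "\<sigma> \<in> sym_grp p" "\<tau> \<in> sym_grp p"
  shows "(\<Sum>L\<in>tuples p. of_bool (L \<circ> \<sigma> = (L :: nat \<Rightarrow> 'a::finite) \<circ> \<tau>))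
    = (of_nat (CARD('a) ^ num_cycles p (\<sigma> \<circ> inv \<tau>)) :: 'b::semiring_1)"
proof -
  have "(\<Sum>L\<in>tuples p. of_bool (L \<circ> \<sigma> = (L :: nat \<Rightarrow> 'a) \<circ> \<tau>))
      = (of_nat (card {L \<in> tuples p. L \<circ> (\<sigma> \<circ> inv \<tau>) = (L :: nat \<Rightarrow> 'a)}) :: 'b)"
    by (simp add: comp_eq_comp_iff[OF assms] sum_of_bool_eq Collect_conj_eq)
  then show ?thesis using assms by (simp add: card_fixed_tuples)
qed

section \<open>Inclusion-exclusion and the permanent\<close>

lemma prod_of_bool: "finite A \<Longrightarrow> (\<Prod>x\<in>A. of_bool (P x)) = (of_bool (\<forall>x\<in>A. P x) :: 'a::comm_semiring_1)"
  by (induction A rule: finite_induct) auto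

text \<open>In terms of the complement Q of S in T, the sum expands the product of (-1 + 1) over T -
  R, which is 1 exactly when this set is empty.\<close>

lemma sum_alternating_supersets:
  assumes "finite T" "R \<subseteq> T"
  shows "(\<Sum>S | R \<subseteq> S \<and> S \<subseteq> T. (- 1) ^ (card T - card S)) = (of_bool (R = T) :: 'a::comm_ring_1)"
proof -
  have "(\<Sum>S | R \<subseteq> S \<and> S \<subseteq> T. (- 1) ^ (card T - card S))
      = (\<Sum>Q\<in>Pow (T - R). (- 1 :: 'a) ^ card Q)"
    by (rule sum.reindex_bij_witness[of _ "\<lambda>Q. T - Q" "\<lambda>S. T - S"])
      (use assms in \<open>auto simp: card_Diff_subset finite_subset double_diff\<close>)
  also have "\<dots> = (\<Prod>x\<in>T - R. (- 1) + 1 :: 'a)"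
    using assms by (subst prod_add) simp_all
  also have "\<dots> = of_bool (R = T)"
    using assms by (auto simp: power_0_left)
  finally show ?thesis .
qed

text \<open>Ryser's formula for the permanent. Each product expands over maps from T into S, and
  inclusion-exclusion keeps the surjective maps, which are the permutations of the finite set
  T.\<close>

lemma Ryser:
  fixes a :: "'b \<Rightarrow> 'b \<Rightarrow> 'a::comm_ring_1"
  assumes T: "finite T"
  shows "(\<Sum>S\<in>Pow T. (- 1) ^ (card T - card S) * (\<Prod>l\<in>T. \<Sum>s\<in>S. a l s))
    = (\<Sum>\<sigma> | \<sigma> permutes T. \<Prod>l\<in>T. a l (\<sigma> l))"
proof -
  let ?E = "PiE T (\<lambda>_. T)"
  have fin: "finite ?E" using T by (simp add: finite_PiE)
  have "(\<Prod>l\<in>T. \<Sum>s\<in>S. a l s) = (\<Sum>f\<in>?E. of_bool (f ` T \<subseteq> S) * (\<Prod>l\<in>T. a l (f l)))"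
    if "S \<in> Pow T" for S
  proof -
    have "(\<Prod>l\<in>T. \<Sum>s\<in>S. a l s) = (\<Sum>f\<in>PiE T (\<lambda>_. S). \<Prod>l\<in>T. a l (f l))"
      using T that by (intro prod_sum_PiE) (auto intro: finite_subset)
    also have "\<dots> = (\<Sum>f\<in>?E. of_bool (f ` T \<subseteq> S) * (\<Prod>l\<in>T. a l (f l)))"
      by (rule sum.mono_neutral_cong_left) (use fin that in \<open>auto simp: PiE_def\<close>)
    finally show ?thesis .
  qed
  then have "(\<Sum>S\<in>Pow T. (- 1) ^ (card T - card S) * (\<Prod>l\<in>T. \<Sum>s\<in>S. a l s))
      = (\<Sum>S\<in>Pow T. \<Sum>f\<in>?E. (\<Prod>l\<in>T. a l (f l)) * (of_bool (f ` T \<subseteq> S) * (- 1) ^ (card T - card S)))"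
    by (simp add: sum_distrib_left mult_ac)
  also have "\<dots> = (\<Sum>f\<in>?E. (\<Prod>l\<in>T. a l (f l)) * (\<Sum>S\<in>Pow T. of_bool (f ` T \<subseteq> S) * (- 1) ^ (card T - card S)))"
    unfolding sum_distrib_left by (rule sum.swap)
  also have "\<dots> = (\<Sum>f\<in>?E. (\<Prod>l\<in>T. a l (f l)) * of_bool (f ` T = T))"
  proof (intro sum.cong refl arg_cong2[where f = "(*)"])
    fix f assume "f \<in> ?E"
    then have "f ` T \<subseteq> T" by auto
    have "(\<Sum>S\<in>Pow T. of_bool (f ` T \<subseteq> S) * (- 1) ^ (card T - card S))
        = (\<Sum>S | f ` T \<subseteq> S \<and> S \<subseteq> T. (- 1 :: 'a) ^ (card T - card S))"
      by (rule sum.mono_neutral_cong_right) (use T in auto)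
    then show "(\<Sum>S\<in>Pow T. of_bool (f ` T \<subseteq> S) * (- 1) ^ (card T - card S)) = (of_bool (f ` T = T) :: 'a)"
      using sum_alternating_supersets[OF T \<open>f ` T \<subseteq> T\<close>] by simp
  qed
  also have "\<dots> = (\<Sum>f\<in>{f \<in> ?E. f ` T = T}. \<Prod>l\<in>T. a l (f l))"
    by (rule sum.mono_neutral_cong_right) (use fin in auto)
  \<comment> \<open>Maps in \<open>?E\<close> take the value \<open>undefined\<close> outside
    \<open>T\<close>, where permutations are the identity; the witnesses translate between the two
    conventions.\<close>
  also have "\<dots> = (\<Sum>\<sigma> | \<sigma> permutes T. \<Prod>l\<in>T. a l (\<sigma> l))"
  proof (rule sum.reindex_bij_witness[of _ "\<lambda>\<sigma>. restrict \<sigma> T" "\<lambda>f x. if x \<in> T then f x else x"])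
    fix f assume f: "f \<in> {f \<in> ?E. f ` T = T}"
    then have "bij_betw f T T" using T by (auto simp: bij_betw_def eq_card_imp_inj_on)
    then have "bij_betw (\<lambda>x. if x \<in> T then f x else x) T T"
      by (subst bij_betw_cong[of T _ f]) auto
    then show "(\<lambda>x. if x \<in> T then f x else x) \<in> {\<sigma>. \<sigma> permutes T}"
      by (auto intro!: bij_imp_permutes)
    show "restrict (\<lambda>x. if x \<in> T then f x else x) T = f"
      using f by (auto simp: fun_eq_iff PiE_def extensional_def)
  next
    fix \<sigma> assume \<sigma>: "\<sigma> \<in> {\<sigma>. \<sigma> permutes T}"
    then show "restrict \<sigma> T \<in> {f \<in> ?E. f ` T = T}"
      by (auto simp: permutes_image permutes_in_image)
    show "(\<lambda>x. if x \<in> T then restrict \<sigma> T x else x) = \<sigma>"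
      using \<sigma> by (auto simp: permutes_not_in)
  qed simp
  finally show ?thesis .
qed


section \<open>Operators commuting with tensor powers\<close>

lemma cnj_of_bool: "cnj (of_bool P) = of_bool P"
  by (cases P) auto

text \<open>Operators on the p-th tensor power are functions of two index tuples and not of a matrix
  type, because their dimension depends on the term \<open>p\<close>.\<close>

definition tensor_power ::
    "nat \<Rightarrow> complex^'n^'m \<Rightarrow> (nat \<Rightarrow> 'm) \<Rightarrow> (nat \<Rightarrow> 'n) \<Rightarrow> complex" where
  "tensor_power p A K L = (\<Prod>l\<in>{1..p}. A $ K l $ L l)"

lemma tensor_power_mult:
  "tensor_power p (A ** B) K L = (\<Sum>M\<in>tuples p. tensor_power p A K M * tensor_power p B M L)"
  unfolding tensor_power_def matrix_matrix_mult_def tuples_def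
  by (simp add: prod_sum_PiE prod.distrib)

lemma tensor_power_scale:
  "tensor_power p (\<chi> i j. c * A $ i $ j) K L = c ^ p * tensor_power p A K L"
  by (simp add: tensor_power_def prod.distrib)

lemma tensor_power_adjoint: "tensor_power p (adjoint_mat A) K L = cnj (tensor_power p A L K)"
  by (simp add: tensor_power_def adjoint_mat_def)

lemma tensor_power_mat_1:
  "K \<in> tuples p \<Longrightarrow> L \<in> tuples p \<Longrightarrow> tensor_power p (mat 1) K L = of_bool (K = L)"
  using prod_of_bool[of "{1..p}" "\<lambda>l. K l = L l"] tuples_eq_iff[of K p L]
  by (simp add: tensor_power_def mat_def of_bool_def)

text \<open>Reindexing the product over the factors by \<sigma>. This is what makes tensor powers
  commute with permutation operators.\<close>

lemma tensor_power_comp: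
  assumes "\<sigma> \<in> sym_grp p"
  shows "tensor_power p A (K \<circ> \<sigma>) L = tensor_power p A K (L \<circ> inv \<sigma>)"
proof -
  have "inv \<sigma> (\<sigma> l) = l" for l
    using fun_cong[OF sym_grp_simps(3)[OF assms], of l] by simp
  then show ?thesis
    using prod_sym_grp[OF assms, of "\<lambda>l. A $ K l $ L (inv \<sigma> l)"] by (simp add: tensor_power_def)
qed

section \<open>Commutation with tensor powers and polynomial continuation\<close>

definition commutes_tensor ::
    "nat \<Rightarrow> ((nat \<Rightarrow> 'm) \<Rightarrow> (nat \<Rightarrow> 'm) \<Rightarrow> complex) \<Rightarrow> complex^'m^'m::finite \<Rightarrow> bool" where
  "commutes_tensor p D A \<longleftrightarrow> (\<forall>K\<in>tuples p. \<forall>L\<in>tuples p.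
     (\<Sum>M\<in>tuples p. D K M * tensor_power p A M L) = (\<Sum>M\<in>tuples p. tensor_power p A K M * D M L))"

lemma commutes_tensor_mult:
  assumes A: "commutes_tensor p D A" and B: "commutes_tensor p D B"
  shows "commutes_tensor p D (A ** B)"
  unfolding commutes_tensor_def
proof (intro ballI)
  fix K L :: "nat \<Rightarrow> 'a" assume K: "K \<in> tuples p" and L: "L \<in> tuples p"
  let ?T = "tensor_power p"
  have "(\<Sum>M\<in>tuples p. D K M * ?T (A ** B) M L)
      = (\<Sum>N\<in>tuples p. (\<Sum>M\<in>tuples p. D K M * ?T A M N) * ?T B N L)"
    unfolding tensor_power_mult sum_distrib_left sum_distrib_right
    by (subst sum.swap) (simp add: mult_ac)
  also have "\<dots> = (\<Sum>N\<in>tuples p. (\<Sum>M\<in>tuples p. ?T A K M * D M N) * ?T B N L)"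
    using A K by (simp add: commutes_tensor_def)
  also have "\<dots> = (\<Sum>M\<in>tuples p. ?T A K M * (\<Sum>N\<in>tuples p. D M N * ?T B N L))"
    unfolding sum_distrib_left sum_distrib_right
    by (subst sum.swap) (simp add: mult_ac)
  also have "\<dots> = (\<Sum>M\<in>tuples p. ?T A K M * (\<Sum>N\<in>tuples p. ?T B M N * D N L))"
    using B L by (simp add: commutes_tensor_def)
  also have "\<dots> = (\<Sum>N\<in>tuples p. ?T (A ** B) K N * D N L)"
    unfolding tensor_power_mult sum_distrib_left sum_distrib_right
    by (subst sum.swap) (simp add: mult_ac)
  finally show "(\<Sum>M\<in>tuples p. D K M * ?T (A ** B) M L) = (\<Sum>M\<in>tuples p. ?T (A ** B) K M * D M L)" .
qed

lemma commutes_tensor_scale: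
  assumes "commutes_tensor p D A"
  shows "commutes_tensor p D (\<chi> i j. c * A $ i $ j)"
  using assms unfolding commutes_tensor_def tensor_power_scale
  by (simp add: mult.left_commute[of _ "c ^ p"] mult.assoc flip: sum_distrib_left)

text \<open>Every entry of the commutator is a polynomial in z, and a polynomial with infinitely
  many roots is zero. All continuation arguments below go through this lemma.\<close>

lemma commutes_tensor_poly:
  fixes F :: "'m::finite \<Rightarrow> 'm \<Rightarrow> complex poly"
  assumes "infinite {z. commutes_tensor p D (\<chi> i j. poly (F i j) z)}"
  shows "commutes_tensor p D (\<chi> i j. poly (F i j) z)"
  unfolding commutes_tensor_def
proof (intro ballI)
  fix K L :: "nat \<Rightarrow> 'm" assume K: "K \<in> tuples p" and L: "L \<in> tuples p"
  define q where "q = (\<Sum>M\<in>tuples p. smult (D K M) (\<Prod>l\<in>{1..p}. F (M l) (L l)))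
    - (\<Sum>M\<in>tuples p. smult (D M L) (\<Prod>l\<in>{1..p}. F (K l) (M l)))"
  have q: "poly q x = (\<Sum>M\<in>tuples p. D K M * tensor_power p (\<chi> i j. poly (F i j) x) M L)
      - (\<Sum>M\<in>tuples p. tensor_power p (\<chi> i j. poly (F i j) x) K M * D M L)" for x
    by (simp add: q_def poly_sum poly_prod tensor_power_def mult.commute)
  have "{z. commutes_tensor p D (\<chi> i j. poly (F i j) z)} \<subseteq> {x. poly q x = 0}"
    using K L by (auto simp: q commutes_tensor_def)
  then have "q = 0" using assms poly_roots_finite finite_subset by blast
  then show "(\<Sum>M\<in>tuples p. D K M * tensor_power p (\<chi> i j. poly (F i j) z) M L)
      = (\<Sum>M\<in>tuples p. tensor_power p (\<chi> i j. poly (F i j) z) K M * D M L)"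
    using q[of z] by simp
qed

section \<open>From unitaries to rank one perturbations of the identity\<close>

definition id_plus_outer :: "complex^'m \<Rightarrow> complex^'m \<Rightarrow> complex^'m^'m" where
  "id_plus_outer v w = (\<chi> i j. of_bool (i = j) + v $ i * w $ j)"

text \<open>The adjoint times the matrix is the identity plus the scalar of the hypothesis times the
  rank one matrix of \<open>v\<close>.\<close>

lemma unitary_id_plus_outer:
  fixes v :: "complex^'m::finite"
  assumes "z + cnj z + (\<Sum>i\<in>UNIV. v $ i * cnj (v $ i)) * z * cnj z = 0"
  shows "unitary_mat (\<chi> i j. of_bool (i = j) + z * (v $ i * cnj (v $ j)))"
proof -
  let ?U = "(\<chi> i j. of_bool (i = j) + z * (v $ i * cnj (v $ j))) :: complex^'m^'m"
  have "(adjoint_mat ?U ** ?U) $ a $ b = mat 1 $ a $ b" for a b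
  proof -
    have "(adjoint_mat ?U ** ?U) $ a $ b
        = (\<Sum>l\<in>UNIV. (of_bool (l = a) + cnj z * (cnj (v $ l) * v $ a)) * (of_bool (l = b) + z * (v $ l * cnj (v $ b))))"
      by (simp add: adjoint_mat_def matrix_matrix_mult_def cnj_of_bool)
    also have "\<dots> = (\<Sum>l\<in>UNIV. (if l = a then of_bool (a = b) + z * (v $ a * cnj (v $ b)) else 0)
        + (if l = b then cnj z * (cnj (v $ b) * v $ a) else 0)
        + v $ a * cnj (v $ b) * z * cnj z * (v $ l * cnj (v $ l)))"
      by (intro sum.cong) (auto simp: algebra_simps)
    also have "\<dots> = of_bool (a = b) + v $ a * cnj (v $ b)
        * (z + cnj z + (\<Sum>i\<in>UNIV. v $ i * cnj (v $ i)) * z * cnj z)"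
    proof -
      define r where "r = (\<Sum>i\<in>UNIV. v $ i * cnj (v $ i))"
      have "(\<Sum>l\<in>UNIV. v $ a * cnj (v $ b) * z * cnj z * (v $ l * cnj (v $ l)))
          = v $ a * cnj (v $ b) * z * cnj z * r"
        by (simp only: r_def sum_distrib_left)
      then show ?thesis
        unfolding sum.distrib r_def[symmetric] by (simp add: algebra_simps)
    qed
    finally show ?thesis using assms by (simp add: mat_def)
  qed
  then have "adjoint_mat ?U ** ?U = mat 1" by (simp add: vec_eq_iff)
  then show ?thesis by (simp add: unitary_mat_def matrix_left_right_inverse)
qed

text \<open>The matrix \<open>1 + z v v\<^sup>*\<close> is unitary for \<open>z\<close> on a circle, which gives all \<open>z\<close>. The line
  \<open>v = a + s b\<close> with real \<open>s\<close> then continues to \<open>s = \<i>\<close>, where \<open>v v\<^sup>*\<close> becomes an arbitrary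
  \<open>v w\<^sup>T\<close>: this removes the complex conjugation.\<close>

lemma commutes_tensor_id_plus_outer:
  fixes D :: "(nat \<Rightarrow> 'm::finite) \<Rightarrow> (nat \<Rightarrow> 'm) \<Rightarrow> complex"
  assumes D: "\<And>U. unitary_mat U \<Longrightarrow> commutes_tensor p D U"
  shows "commutes_tensor p D (id_plus_outer v w)"
proof -
  have hermitian: "commutes_tensor p D (\<chi> i j. of_bool (i = j) + z * (v $ i * cnj (v $ j)))"
    for v :: "complex^'m" and z
  proof -
    define r where "r = (\<Sum>i\<in>UNIV. (cmod (v $ i))\<^sup>2)"
    have r: "(\<Sum>i\<in>UNIV. v $ i * cnj (v $ i)) = complex_of_real r"
      by (simp add: r_def complex_norm_square del: of_real_power)
    \<comment> \<open>Inversion maps the circle z + cnj z + r |z|^2 = 0 to the line Re (1/z) = -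
      r/2, which gives this parametrization. Taking s > 0 avoids inverting 0, also when r =
      0.\<close>
    define g where "g s = inverse (Complex (- r / 2) s)" for s
    let ?F = "\<lambda>i j. [:of_bool (i = j), v $ i * cnj (v $ j):]"
    have "g s \<in> {z. commutes_tensor p D (\<chi> i j. poly (?F i j) z)}" if "s \<in> {0<..}" for s
    proof -
      let ?y = "Complex (- r / 2) s"
      have "?y \<noteq> 0" "cnj ?y \<noteq> 0" using that by (auto simp: complex_eq_iff)
      moreover have "?y + cnj ?y + of_real r = 0" by (simp add: complex_eq_iff)
      ultimately have "inverse ?y + inverse (cnj ?y) + of_real r * inverse ?y * inverse (cnj ?y) = 0"
        by (simp add: divide_simps add.commute)
      then have "unitary_mat (\<chi> i j. of_bool (i = j) + g s * (v $ i * cnj (v $ j)))"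
        by (intro unitary_id_plus_outer) (simp add: r g_def)
      then show ?thesis using D by simp
    qed
    moreover have "infinite (g ` {0<..})"
      by (subst finite_image_iff) (auto simp: inj_on_def g_def infinite_Ioi)
    ultimately have "infinite {z. commutes_tensor p D (\<chi> i j. poly (?F i j) z)}"
      by (meson finite_subset image_subsetI)
    from commutes_tensor_poly[OF this, of z] show ?thesis by simp
  qed
  \<comment> \<open>Chosen so that a + i b = v and cnj a + i cnj b = w.\<close>
  define a where "a = (\<chi> i. (v $ i + cnj (w $ i)) / 2)"
  define b where "b = (\<chi> i. (v $ i - cnj (w $ i)) / (2 * \<i>))"
  \<comment> \<open>Only the constant vectors are conjugated, so the entries are polynomials in s;
    for real s they are those of the hermitian perturbation by the vector a + s b.\<close>
  let ?F = "\<lambda>i j. [:of_bool (i = j):] + [:a $ i, b $ i:] * [:cnj (a $ j), cnj (b $ j):]"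
  have "commutes_tensor p D (\<chi> i j. poly (?F i j) (of_real s))" for s
    using hermitian[of 1 "\<chi> i. a $ i + of_real s * b $ i"] by (simp add: algebra_simps)
  then have "range complex_of_real \<subseteq> {z. commutes_tensor p D (\<chi> i j. poly (?F i j) z)}"
    by blast
  moreover have "infinite (range complex_of_real)"
    by (simp add: finite_image_iff inj_of_real infinite_UNIV_char_0)
  ultimately have "infinite {z. commutes_tensor p D (\<chi> i j. poly (?F i j) z)}"
    using finite_subset by blast
  from commutes_tensor_poly[OF this, of \<i>] have "commutes_tensor p D (\<chi> i j. poly (?F i j) \<i>)" .
  moreover have "poly (?F i j) \<i> = of_bool (i = j) + v $ i * w $ j" for i j
  proof -
    have "a $ i + \<i> * b $ i = v $ i" by (simp add: a_def b_def field_simps)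
    moreover have "cnj (a $ j) + \<i> * cnj (b $ j) = w $ j" by (simp add: a_def b_def field_simps)
    moreover have "poly (?F i j) \<i> = of_bool (i = j)
        + (a $ i + \<i> * b $ i) * (cnj (a $ j) + \<i> * cnj (b $ j))"
      by (simp add: algebra_simps)
    ultimately show ?thesis by simp
  qed
  ultimately show ?thesis by (simp only: id_plus_outer_def)
qed

lemma commutes_tensor_add_outer:
  fixes A :: "complex^'m^'m::finite"
  assumes D: "\<And>U. unitary_mat U \<Longrightarrow> commutes_tensor p D U"
    and A: "commutes_tensor p D A" "det A \<noteq> 0"
  shows "commutes_tensor p D (A + (\<chi> i j. v $ i * w $ j))"
proof -
  obtain B where B: "A ** B = mat 1"
    using A(2) by (auto simp: invertible_det_nz[symmetric] invertible_def)
  have "(A ** id_plus_outer (B *v v) w) $ i $ j = A $ i $ j + v $ i * w $ j" for i j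
  proof -
    have "(A ** id_plus_outer (B *v v) w) $ i $ j
        = (\<Sum>k\<in>UNIV. (if k = j then A $ i $ j else 0) + A $ i $ k * (B *v v) $ k * w $ j)"
      unfolding matrix_matrix_mult_def id_plus_outer_def
      by (auto simp: algebra_simps intro!: sum.cong)
    also have "\<dots> = A $ i $ j + (A *v (B *v v)) $ i * w $ j"
      by (simp add: sum.distrib matrix_vector_mult_def[of A] sum_distrib_right)
    finally show ?thesis by (simp add: matrix_vector_mul_assoc B)
  qed
  then have "A ** id_plus_outer (B *v v) w = A + (\<chi> i j. v $ i * w $ j)"
    by (simp add: vec_eq_iff)
  then show ?thesis
    using commutes_tensor_mult[OF A(1) commutes_tensor_id_plus_outer[OF D]] by metis
qed

section \<open>Sums of matrix units and polarization\<close>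

definition unit_sum :: "'s set \<Rightarrow> ('s \<Rightarrow> 'm) \<Rightarrow> ('s \<Rightarrow> 'm) \<Rightarrow> 'm \<Rightarrow> 'm \<Rightarrow> complex" where
  "unit_sum S I J i j = (\<Sum>s\<in>S. of_bool (i = I s \<and> j = J s))"

text \<open>Near the identity every matrix is invertible, so the rank one summands can be added one at a
  time: \<open>A + v w\<^sup>T = A (1 + (A\<^sup>-\<^sup>1 v) w\<^sup>T)\<close>.\<close>

lemma commutes_tensor_unit_sum:
  fixes D :: "(nat \<Rightarrow> 'm::finite) \<Rightarrow> (nat \<Rightarrow> 'm) \<Rightarrow> complex"
  assumes D: "\<And>U. unitary_mat U \<Longrightarrow> commutes_tensor p D U"
    and S: "finite S"
  shows "commutes_tensor p D (\<chi> i j. unit_sum S I J i j)"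
proof -
  let ?A = "\<lambda>S t. (\<chi> i j. of_bool (i = j) + t * unit_sum S I J i j) :: complex^'m^'m"
  have near: "eventually (\<lambda>t. commutes_tensor p D (?A S t)) (at 0)"
    using S
  proof (induction S rule: finite_induct)
    case empty
    have "commutes_tensor p D (id_plus_outer 0 0)"
      by (rule commutes_tensor_id_plus_outer[OF D])
    then show ?case by (simp add: unit_sum_def id_plus_outer_def)
  next
    case (insert s S)
    have "((\<lambda>t. det (?A S t)) \<longlongrightarrow> det (?A S 0)) (at 0)"
      unfolding det_def by (intro tendsto_intros)
    moreover have "?A S 0 = mat 1" by (simp add: mat_def vec_eq_iff)
    ultimately have "eventually (\<lambda>t. det (?A S t) \<noteq> 0) (at 0)"
      by (intro tendsto_imp_eventually_ne[where c = 1]) auto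
    with insert.IH show ?case
    proof eventually_elim
      case (elim t)
      have "?A S t + (\<chi> i j. (\<chi> i. t * of_bool (i = I s)) $ i * (\<chi> j. of_bool (j = J s)) $ j) = ?A (insert s S) t"
        using insert.hyps by (simp add: vec_eq_iff unit_sum_def algebra_simps)
      with commutes_tensor_add_outer[OF D elim, of "\<chi> i. t * of_bool (i = I s)" "\<chi> j. of_bool (j = J s)"]
      show ?case by (simp only:)
    qed
  qed
  have all: "commutes_tensor p D (?A S t)" for t
  proof -
    let ?F = "\<lambda>i j. [:of_bool (i = j), unit_sum S I J i j:]"
    \<comment> \<open>A punctured neighbourhood of 0 consists of admissible parameters, whereas a
      finite set does not accumulate at 0.\<close>
    have "infinite {z. commutes_tensor p D (\<chi> i j. poly (?F i j) z)}"
    proof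
      assume fin: "finite {z. commutes_tensor p D (\<chi> i j. poly (?F i j) z)}"
      then have "\<not> 0 islimpt {z. commutes_tensor p D (\<chi> i j. poly (?F i j) z)}"
        by (rule islimpt_finite)
      then have "eventually (\<lambda>t. \<not> commutes_tensor p D (?A S t)) (at 0)"
        by (simp add: islimpt_iff_eventually)
      with near have "eventually (\<lambda>t::complex. False) (at 0)" by eventually_elim simp
      then show False by simp
    qed
    from commutes_tensor_poly[OF this, of t] show ?thesis by simp
  qed
  \<comment> \<open>Multiplying \<open>?A S (1 / z)\<close> by z interchanges the two coefficients,
    so that continuation to z = 0 removes the identity.\<close>
  let ?F = "\<lambda>i j. [:unit_sum S I J i j, of_bool (i = j):]"
  have "commutes_tensor p D (\<chi> i j. poly (?F i j) z)" if "z \<noteq> 0" for z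
  proof -
    have "(\<chi> i j. z * ?A S (1 / z) $ i $ j) = (\<chi> i j. poly (?F i j) z)"
      using that by (simp add: vec_eq_iff field_simps)
    with commutes_tensor_scale[OF all[of "1 / z"], of z] show ?thesis by (simp only:)
  qed
  then have "- {0} \<subseteq> {z. commutes_tensor p D (\<chi> i j. poly (?F i j) z)}" by auto
  moreover have "infinite (- {0 :: complex})"
    by (simp add: Compl_eq_Diff_UNIV infinite_UNIV_char_0)
  ultimately have "infinite {z. commutes_tensor p D (\<chi> i j. poly (?F i j) z)}"
    using finite_subset by blast
  from commutes_tensor_poly[OF this, of 0] show ?thesis by simp
qed

text \<open>Polarization: an entry of the tensor power is a product over l of sums over S, so
  Ryser's formula applies and leaves the symmetrized matrix unit at (I, J).\<close>

lemma Ryser_unit_sum: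
  assumes "K \<in> tuples p" "L \<in> tuples p" "I \<in> tuples p" "J \<in> tuples p"
  shows "(\<Sum>S\<in>Pow {1..p}. (- 1) ^ (p - card S) * tensor_power p (\<chi> i j. unit_sum S I J i j) K L)
    = (\<Sum>\<sigma>\<in>sym_grp p. of_bool (K = I \<circ> \<sigma>) * of_bool (L = J \<circ> \<sigma>))"
proof -
  have "(\<Sum>S\<in>Pow {1..p}. (- 1) ^ (p - card S) * tensor_power p (\<chi> i j. unit_sum S I J i j) K L)
      = (\<Sum>\<sigma>\<in>sym_grp p. \<Prod>l\<in>{1..p}. of_bool (K l = I (\<sigma> l) \<and> L l = J (\<sigma> l)))"
    using Ryser[of "{1..p}" "\<lambda>l s. of_bool (K l = I s \<and> L l = J s) :: complex"]
    by (simp add: tensor_power_def unit_sum_def sym_grp_def)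
  also have "\<dots> = (\<Sum>\<sigma>\<in>sym_grp p. of_bool (K = I \<circ> \<sigma>) * of_bool (L = J \<circ> \<sigma>))"
  proof (intro sum.cong refl)
    fix \<sigma> assume \<sigma>: "\<sigma> \<in> sym_grp p"
    have eq: "(\<forall>l\<in>{1..p}. K l = I (\<sigma> l) \<and> L l = J (\<sigma> l)) \<longleftrightarrow> K = I \<circ> \<sigma> \<and> L = J \<circ> \<sigma>"
      using tuples_eq_iff[of K p "I \<circ> \<sigma>"] tuples_eq_iff[of L p "J \<circ> \<sigma>"] assms \<sigma> by auto
    show "(\<Prod>l\<in>{1..p}. of_bool (K l = I (\<sigma> l) \<and> L l = J (\<sigma> l)))
        = (of_bool (K = I \<circ> \<sigma>) * of_bool (L = J \<circ> \<sigma>) :: complex)"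
      by (simp only: of_bool_conj[symmetric] prod_of_bool[OF finite_atLeastAtMost] eq)
  qed
  finally show ?thesis .
qed

text \<open>Commutation with D is a linear condition, so it passes from tensor powers of sums of
  matrix units to their signed combination. The equation is the (K, L) entry of the result.\<close>

lemma commutes_symmetrized_unit:
  fixes D :: "(nat \<Rightarrow> 'm::finite) \<Rightarrow> (nat \<Rightarrow> 'm) \<Rightarrow> complex"
  assumes D: "\<And>U. unitary_mat U \<Longrightarrow> commutes_tensor p D U"
    and tuples: "K \<in> tuples p" "L \<in> tuples p" "I \<in> tuples p" "J \<in> tuples p"
  shows "(\<Sum>\<sigma>\<in>sym_grp p. D K (I \<circ> \<sigma>) * of_bool (L = J \<circ> \<sigma>))
    = (\<Sum>\<sigma>\<in>sym_grp p. of_bool (K = I \<circ> \<sigma>) * D (J \<circ> \<sigma>) L)"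
proof -
  let ?T = "\<lambda>S. tensor_power p (\<chi> i j. unit_sum S I J i j)"
  have "(\<Sum>\<sigma>\<in>sym_grp p. D K (I \<circ> \<sigma>) * of_bool (L = J \<circ> \<sigma>))
      = (\<Sum>\<sigma>\<in>sym_grp p. \<Sum>M\<in>tuples p. D K M * (of_bool (M = I \<circ> \<sigma>) * of_bool (L = J \<circ> \<sigma>)))"
  proof (intro sum.cong refl)
    fix \<sigma> assume \<sigma>: "\<sigma> \<in> sym_grp p"
    have "(\<Sum>M\<in>tuples p. D K M * (of_bool (M = I \<circ> \<sigma>) * of_bool (L = J \<circ> \<sigma>)))
        = (\<Sum>M\<in>tuples p. if M = I \<circ> \<sigma> then D K (I \<circ> \<sigma>) * of_bool (L = J \<circ> \<sigma>) else 0)"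
      by (intro sum.cong) auto
    then show "D K (I \<circ> \<sigma>) * of_bool (L = J \<circ> \<sigma>)
        = (\<Sum>M\<in>tuples p. D K M * (of_bool (M = I \<circ> \<sigma>) * of_bool (L = J \<circ> \<sigma>)))"
      using tuples \<sigma> by simp
  qed
  also have "\<dots> = (\<Sum>M\<in>tuples p. D K M * (\<Sum>\<sigma>\<in>sym_grp p. of_bool (M = I \<circ> \<sigma>) * of_bool (L = J \<circ> \<sigma>)))"
    unfolding sum_distrib_left by (rule sum.swap)
  also have "\<dots> = (\<Sum>M\<in>tuples p. D K M * (\<Sum>S\<in>Pow {1..p}. (- 1) ^ (p - card S) * ?T S M L))"
    using tuples by (intro sum.cong refl) (simp only: Ryser_unit_sum)
  also have "\<dots> = (\<Sum>S\<in>Pow {1..p}. (- 1) ^ (p - card S) * (\<Sum>M\<in>tuples p. D K M * ?T S M L))"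
    unfolding sum_distrib_left by (subst sum.swap) (simp add: mult_ac)
  also have "\<dots> = (\<Sum>S\<in>Pow {1..p}. (- 1) ^ (p - card S) * (\<Sum>M\<in>tuples p. ?T S K M * D M L))"
  proof (rule sum.cong[OF refl])
    fix S assume "S \<in> Pow {1..p}"
    then have "finite S" by (auto intro: finite_subset)
    then show "(- 1) ^ (p - card S) * (\<Sum>M\<in>tuples p. D K M * ?T S M L)
        = (- 1) ^ (p - card S) * (\<Sum>M\<in>tuples p. ?T S K M * D M L)"
      using commutes_tensor_unit_sum[OF D, of S I J] tuples by (simp add: commutes_tensor_def)
  qed
  also have "\<dots> = (\<Sum>M\<in>tuples p. (\<Sum>S\<in>Pow {1..p}. (- 1) ^ (p - card S) * ?T S K M) * D M L)"
    unfolding sum_distrib_left sum_distrib_right by (subst sum.swap) (simp add: mult_ac)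
  also have "\<dots> = (\<Sum>M\<in>tuples p. (\<Sum>\<sigma>\<in>sym_grp p. of_bool (K = I \<circ> \<sigma>) * of_bool (M = J \<circ> \<sigma>)) * D M L)"
    using tuples by (intro sum.cong refl) (simp only: Ryser_unit_sum)
  also have "\<dots> = (\<Sum>\<sigma>\<in>sym_grp p. \<Sum>M\<in>tuples p. of_bool (K = I \<circ> \<sigma>) * of_bool (M = J \<circ> \<sigma>) * D M L)"
    unfolding sum_distrib_right by (rule sum.swap)
  also have "\<dots> = (\<Sum>\<sigma>\<in>sym_grp p. of_bool (K = I \<circ> \<sigma>) * D (J \<circ> \<sigma>) L)"
  proof (intro sum.cong refl)
    fix \<sigma> assume \<sigma>: "\<sigma> \<in> sym_grp p"
    have "(\<Sum>M\<in>tuples p. of_bool (K = I \<circ> \<sigma>) * of_bool (M = J \<circ> \<sigma>) * D M L)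
        = (\<Sum>M\<in>tuples p. if M = J \<circ> \<sigma> then of_bool (K = I \<circ> \<sigma>) * D (J \<circ> \<sigma>) L else 0)"
      by (intro sum.cong) auto
    then show "(\<Sum>M\<in>tuples p. of_bool (K = I \<circ> \<sigma>) * of_bool (M = J \<circ> \<sigma>) * D M L)
        = of_bool (K = I \<circ> \<sigma>) * D (J \<circ> \<sigma>) L"
      using tuples \<sigma> by simp
  qed
  finally show ?thesis .
qed

text \<open>Let \<open>C\<close> be the symmetrized matrix unit at \<open>(I, J)\<close>. In \<open>D C = C D\<close> the column \<open>J\<close> of the right-hand
  side, as a function \<open>F\<close> of the row \<open>K\<close> and of \<open>I\<close>, is a combination of permutation operators, while
  the left-hand side makes it orthogonal to all of them. Hence \<open>F = 0\<close>, and \<open>I = J\<close> on the left yields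
  a positive multiple of \<open>D K J\<close>.\<close>

lemma commutes_tensor_orthogonal_zero:
  fixes D :: "(nat \<Rightarrow> 'm::finite) \<Rightarrow> (nat \<Rightarrow> 'm) \<Rightarrow> complex"
  assumes D: "\<And>U. unitary_mat U \<Longrightarrow> commutes_tensor p D U"
    and orth: "\<And>\<tau>. \<tau> \<in> sym_grp p \<Longrightarrow> (\<Sum>L\<in>tuples p. D L (L \<circ> \<tau>)) = 0"
    and K: "K \<in> tuples p" and J: "J \<in> tuples p"
  shows "D K J = 0"
proof -
  define F where "F K I = (\<Sum>\<sigma>\<in>sym_grp p. of_bool (K = I \<circ> \<sigma>) * D (J \<circ> \<sigma>) J)" for K I :: "nat \<Rightarrow> 'm"
  have F: "F K I = (\<Sum>\<sigma>\<in>sym_grp p. D K (I \<circ> \<sigma>) * of_bool (J = J \<circ> \<sigma>))"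
    if "K \<in> tuples p" "I \<in> tuples p" for K I
    using commutes_symmetrized_unit[OF D that(1) J that(2) J] by (simp add: F_def)
  \<comment> \<open>Here the form \<open>F\<close> from the other side of the commutation is used:
    reindexing I by \<sigma> turns each inner sum into a trace covered by
    \<open>orth\<close>.\<close>
  have F0: "(\<Sum>I\<in>tuples p. F (I \<circ> \<sigma>) I) = 0" if \<sigma>: "\<sigma> \<in> sym_grp p" for \<sigma>
  proof -
    have "(\<Sum>I\<in>tuples p. F (I \<circ> \<sigma>) I)
        = (\<Sum>I\<in>tuples p. \<Sum>\<tau>\<in>sym_grp p. D (I \<circ> \<sigma>) (I \<circ> \<tau>) * of_bool (J = J \<circ> \<tau>))"
      using \<sigma> by (simp add: F)
    also have "\<dots> = (\<Sum>\<tau>\<in>sym_grp p. (\<Sum>I\<in>tuples p. D (I \<circ> \<sigma>) (I \<circ> \<tau>)) * of_bool (J = J \<circ> \<tau>))"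
      unfolding sum_distrib_right by (rule sum.swap)
    also have "\<dots> = 0"
    proof (intro sum.neutral ballI)
      fix \<tau> assume \<tau>: "\<tau> \<in> sym_grp p"
      have "(\<Sum>I\<in>tuples p. D (I \<circ> \<sigma>) (I \<circ> \<tau>)) = (\<Sum>I\<in>tuples p. D (I \<circ> \<sigma>) ((I \<circ> \<sigma>) \<circ> (inv \<sigma> \<circ> \<tau>)))"
        using \<sigma> by (simp add: o_assoc[symmetric])
      also have "\<dots> = (\<Sum>I\<in>tuples p. D I (I \<circ> (inv \<sigma> \<circ> \<tau>)))"
        using sum_tuples_comp[OF \<sigma>, of "\<lambda>I. D I (I \<circ> (inv \<sigma> \<circ> \<tau>))"] by simp
      also have "\<dots> = 0" using orth \<sigma> \<tau> by simp
      finally show "(\<Sum>I\<in>tuples p. D (I \<circ> \<sigma>) (I \<circ> \<tau>)) * of_bool (J = J \<circ> \<tau>) = 0" by simp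
    qed
    finally show ?thesis .
  qed
  \<comment> \<open>Only the conjugated factor is expanded into permutation operators, which pairs
    \<open>F\<close> with each of them as in \<open>F0\<close>.\<close>
  have "(\<Sum>I\<in>tuples p. \<Sum>K\<in>tuples p. F K I * cnj (F K I))
      = (\<Sum>I\<in>tuples p. \<Sum>\<sigma>\<in>sym_grp p. cnj (D (J \<circ> \<sigma>) J) * F (I \<circ> \<sigma>) I)"
  proof (intro sum.cong refl)
    fix I :: "nat \<Rightarrow> 'm" assume I: "I \<in> tuples p"
    have "(\<Sum>K\<in>tuples p. F K I * cnj (F K I))
        = (\<Sum>\<sigma>\<in>sym_grp p. \<Sum>K\<in>tuples p. F K I * (of_bool (K = I \<circ> \<sigma>) * cnj (D (J \<circ> \<sigma>) J)))"
    proof (subst sum.swap, rule sum.cong[OF refl])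
      fix K
      have "cnj (F K I) = (\<Sum>\<sigma>\<in>sym_grp p. of_bool (K = I \<circ> \<sigma>) * cnj (D (J \<circ> \<sigma>) J))"
        unfolding F_def cnj_sum complex_cnj_mult cnj_of_bool ..
      then show "F K I * cnj (F K I)
          = (\<Sum>\<sigma>\<in>sym_grp p. F K I * (of_bool (K = I \<circ> \<sigma>) * cnj (D (J \<circ> \<sigma>) J)))"
        by (simp only: sum_distrib_left)
    qed
    also have "\<dots> = (\<Sum>\<sigma>\<in>sym_grp p. cnj (D (J \<circ> \<sigma>) J) * F (I \<circ> \<sigma>) I)"
    proof (intro sum.cong refl)
      fix \<sigma> assume \<sigma>: "\<sigma> \<in> sym_grp p"
      have "(\<Sum>K\<in>tuples p. F K I * (of_bool (K = I \<circ> \<sigma>) * cnj (D (J \<circ> \<sigma>) J)))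
          = (\<Sum>K\<in>tuples p. if K = I \<circ> \<sigma> then cnj (D (J \<circ> \<sigma>) J) * F (I \<circ> \<sigma>) I else 0)"
        by (intro sum.cong) auto
      then show "(\<Sum>K\<in>tuples p. F K I * (of_bool (K = I \<circ> \<sigma>) * cnj (D (J \<circ> \<sigma>) J)))
          = cnj (D (J \<circ> \<sigma>) J) * F (I \<circ> \<sigma>) I"
        using I \<sigma> by simp
    qed
    finally show "(\<Sum>K\<in>tuples p. F K I * cnj (F K I))
        = (\<Sum>\<sigma>\<in>sym_grp p. cnj (D (J \<circ> \<sigma>) J) * F (I \<circ> \<sigma>) I)" .
  qed
  also have "\<dots> = 0"
    by (subst sum.swap) (simp add: F0 flip: sum_distrib_left)
  finally have "complex_of_real (\<Sum>I\<in>tuples p. \<Sum>K\<in>tuples p. (cmod (F K I))\<^sup>2) = 0"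
    by (simp add: complex_norm_square del: of_real_power)
  then have "(\<Sum>I\<in>tuples p. \<Sum>K\<in>tuples p. (cmod (F K I))\<^sup>2) = 0"
    by (simp only: of_real_eq_0_iff)
  then have "F K J = 0"
    using K J by (simp add: sum_nonneg_eq_0_iff sum_nonneg)
  \<comment> \<open>Each \<sigma> in the stabilizer of J contributes D K J, and the stabilizer
    contains \<open>id\<close>.\<close>
  moreover have "F K J = D K J * of_nat (card {\<sigma> \<in> sym_grp p. J = J \<circ> \<sigma>})"
  proof -
    have "F K J = (\<Sum>\<sigma>\<in>sym_grp p. D K J * of_bool (J = J \<circ> \<sigma>))"
      unfolding F[OF K J] by (intro sum.cong) auto
    then show ?thesis
      by (simp add: sum_of_bool_eq Collect_conj_eq flip: sum_distrib_left)
  qed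
  moreover have "card {\<sigma> \<in> sym_grp p. J = J \<circ> \<sigma>} \<noteq> 0"
    using id_sym_grp[of p] by (auto simp: card_eq_0_iff simp del: id_sym_grp)
  ultimately show ?thesis by simp
qed


section \<open>Expansion in permutation operators\<close>

text \<open>The squared norm of the combination of permutation operators is the Gram form at
  \<open>y\<close>, so a coefficient vector in the kernel of the Gram matrix represents the zero
  operator.\<close>

lemma annihilated_perm_sum_zero:
  fixes L K :: "nat \<Rightarrow> 'm::finite"
  assumes y: "conv p y (cycle_weight CARD('m) p) = (\<lambda>_. 0)"
    and "L \<in> tuples p" "K \<in> tuples p"
  shows "(\<Sum>\<sigma>\<in>sym_grp p. y \<sigma> * of_bool (K = L \<circ> \<sigma>)) = 0"
proof -
  define Y where "Y L K = (\<Sum>\<sigma>\<in>sym_grp p. y \<sigma> * of_bool (K = L \<circ> \<sigma>))" for L K :: "nat \<Rightarrow> 'm"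
  have "(\<Sum>L\<in>tuples p. \<Sum>K\<in>tuples p. (Y L K)\<^sup>2) = (\<Sum>L\<in>tuples p. \<Sum>\<tau>\<in>sym_grp p. y \<tau> * Y L (L \<circ> \<tau>))"
  proof (rule sum.cong[OF refl])
    fix L :: "nat \<Rightarrow> 'm" assume L: "L \<in> tuples p"
    have "(\<Sum>K\<in>tuples p. (Y L K)\<^sup>2) = (\<Sum>\<tau>\<in>sym_grp p. \<Sum>K\<in>tuples p. Y L K * (y \<tau> * of_bool (K = L \<circ> \<tau>)))"
      by (subst sum.swap) (simp only: power2_eq_square Y_def[of L] sum_distrib_left)
    also have "\<dots> = (\<Sum>\<tau>\<in>sym_grp p. y \<tau> * Y L (L \<circ> \<tau>))"
    proof (rule sum.cong[OF refl])
      fix \<tau> assume \<tau>: "\<tau> \<in> sym_grp p"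
      have "(\<Sum>K\<in>tuples p. Y L K * (y \<tau> * of_bool (K = L \<circ> \<tau>)))
          = (\<Sum>K\<in>tuples p. if K = L \<circ> \<tau> then y \<tau> * Y L (L \<circ> \<tau>) else 0)"
        by (intro sum.cong) auto
      then show "(\<Sum>K\<in>tuples p. Y L K * (y \<tau> * of_bool (K = L \<circ> \<tau>))) = y \<tau> * Y L (L \<circ> \<tau>)"
        using L \<tau> by simp
    qed
    finally show "(\<Sum>K\<in>tuples p. (Y L K)\<^sup>2) = (\<Sum>\<tau>\<in>sym_grp p. y \<tau> * Y L (L \<circ> \<tau>))" .
  qed
  also have "\<dots> = (\<Sum>\<tau>\<in>sym_grp p. y \<tau> * (\<Sum>L\<in>tuples p. Y L (L \<circ> \<tau>)))"
    by (subst sum.swap) (simp add: sum_distrib_left)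
  also have "\<dots> = 0"
  proof (intro sum.neutral ballI)
    fix \<tau> assume \<tau>: "\<tau> \<in> sym_grp p"
    have "(\<Sum>L\<in>tuples p. Y L (L \<circ> \<tau>))
        = (\<Sum>\<sigma>\<in>sym_grp p. y \<sigma> * (\<Sum>L\<in>tuples p. of_bool (L \<circ> \<sigma> = (L :: nat \<Rightarrow> 'm) \<circ> \<tau>)))"
      unfolding Y_def sum_distrib_left by (subst sum.swap) (simp only: eq_commute[of "_ \<circ> \<tau>"])
    also have "\<dots> = conv p y (cycle_weight CARD('m) p) \<tau>"
      unfolding conv_def using \<tau>
      by (auto simp: sum_of_bool_comp_eq cycle_weight_def num_cycles_inv_comp simp del: sum_of_bool_eq intro!: sum.cong)
    finally show "y \<tau> * (\<Sum>L\<in>tuples p. Y L (L \<circ> \<tau>)) = 0" by (simp add: y)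
  qed
  finally have "Y L K = 0"
    using assms(2,3) by (simp add: sum_nonneg_eq_0_iff sum_nonneg)
  then show ?thesis by (simp add: Y_def)
qed

text \<open>The traces \<open>t\<close> are orthogonal to the kernel of the Gram matrix \<open>\<sigma>, \<tau> \<mapsto> N\<^bsup>#(\<sigma>\<^sup>-\<^sup>1\<tau>)\<^esup>\<close>, because a
  combination of permutation operators in this kernel is the zero operator. So the pseudo-inverse
  solves the Gram system exactly, also when \<open>p > N\<close>.\<close>

lemma gram_solution:
  fixes B :: "(nat \<Rightarrow> 'm::finite) \<Rightarrow> (nat \<Rightarrow> 'm) \<Rightarrow> complex"
  assumes t: "t \<in> grp_alg p"
    and B: "\<And>\<tau>. \<tau> \<in> sym_grp p \<Longrightarrow> (\<Sum>L\<in>tuples p. B L (L \<circ> \<tau>)) = complex_of_real (t \<tau>)"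
  shows "conv p (conv p t (Wg CARD('m) p)) (cycle_weight CARD('m) p) = t"
proof -
  let ?G = "cycle_weight CARD('m) p" and ?w = "Wg CARD('m) p"
  define y where "y \<sigma> = t \<sigma> - conv p (conv p t ?w) ?G \<sigma>" for \<sigma>
  have y_alg: "y \<in> grp_alg p"
    using t by (simp add: y_def grp_alg_def conv_def)
  have GwG: "conv p (conv p ?G ?w) ?G = ?G"
    using Wg_pseudo_inverse[of p "CARD('m)"] by (simp add: pseudo_inverse_def)
  \<comment> \<open>As \<open>?w\<close> commutes with \<open>?G\<close>, t w G G = t G w G = t G;
    hence the residual \<open>y\<close> lies in the kernel.\<close>
  have "conv p (conv p (conv p t ?w) ?G) ?G = conv p t ?G"
    by (metis GwG Wg_commute conv_assoc)
  then have yG: "conv p y ?G = (\<lambda>_. 0)"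
    by (simp add: y_def[abs_def] conv_diff_left)
  \<comment> \<open>The star of t w G begins with a factor \<open>?G\<close>, so \<open>y\<close> is
    orthogonal to t w G and its squared norm is its pairing with \<open>t\<close>.\<close>
  have "star p (conv p (conv p t ?w) ?G) = conv p ?G (star p (conv p t ?w))"
    by (simp add: star_conv star_cycle_weight)
  then have "conv p y (star p (conv p (conv p t ?w) ?G)) = (\<lambda>_. 0)"
    by (simp only: conv_assoc[symmetric] yG conv_zero_left)
  then have "conv p y (star p y) = conv p y (star p t)"
    by (subst (2) y_def[abs_def]) (simp add: star_diff conv_diff_right)
  then have "(\<Sum>\<sigma>\<in>sym_grp p. (y \<sigma>)\<^sup>2) = conv p y (star p t) id"
    using conv_star_id[of p y] by simp
  also have "\<dots> = (\<Sum>\<sigma>\<in>sym_grp p. y \<sigma> * t \<sigma>)"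
    by (simp add: conv_def star_def)
  also have "\<dots> = 0"
  proof -
    \<comment> \<open>This pairing is that of \<open>B\<close> with the combination of permutation
      operators with coefficients \<open>y\<close>, which is the zero operator.\<close>
    have "complex_of_real (\<Sum>\<sigma>\<in>sym_grp p. y \<sigma> * t \<sigma>)
        = (\<Sum>\<sigma>\<in>sym_grp p. \<Sum>L\<in>tuples p. of_real (y \<sigma>) * B L (L \<circ> \<sigma>))"
      by (simp add: B flip: sum_distrib_left)
    also have "\<dots> = (\<Sum>\<sigma>\<in>sym_grp p. \<Sum>L\<in>tuples p. \<Sum>K\<in>tuples p. of_real (y \<sigma> * of_bool (K = L \<circ> \<sigma>)) * B L K)"
    proof (intro sum.cong refl)
      fix \<sigma> and L :: "nat \<Rightarrow> 'm" assume "\<sigma> \<in> sym_grp p" "L \<in> tuples p"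
      moreover have "(\<Sum>K\<in>tuples p. of_real (y \<sigma> * of_bool (K = L \<circ> \<sigma>)) * B L K)
          = (\<Sum>K\<in>tuples p. if K = L \<circ> \<sigma> then of_real (y \<sigma>) * B L (L \<circ> \<sigma>) else 0)"
        by (intro sum.cong) auto
      ultimately show "of_real (y \<sigma>) * B L (L \<circ> \<sigma>)
          = (\<Sum>K\<in>tuples p. of_real (y \<sigma> * of_bool (K = L \<circ> \<sigma>)) * B L K)" by simp
    qed
    also have "\<dots> = (\<Sum>L\<in>tuples p. \<Sum>K\<in>tuples p. \<Sum>\<sigma>\<in>sym_grp p. of_real (y \<sigma> * of_bool (K = L \<circ> \<sigma>)) * B L K)"
      by (subst sum.swap) (intro sum.cong refl sum.swap)
    also have "\<dots> = (\<Sum>L\<in>tuples p. \<Sum>K\<in>tuples p. of_real (\<Sum>\<sigma>\<in>sym_grp p. y \<sigma> * of_bool (K = L \<circ> \<sigma>)) * B L K)"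
      unfolding of_real_sum sum_distrib_right ..
    also have "\<dots> = 0"
      using annihilated_perm_sum_zero[OF yG] by (intro sum.neutral ballI) (simp only: of_real_0 mult_zero_left)
    finally show ?thesis by (simp only: of_real_eq_0_iff)
  qed
  finally have "\<forall>\<sigma>\<in>sym_grp p. y \<sigma> = 0" by (simp add: sum_nonneg_eq_0_iff)
  then have "y \<sigma> = 0" for \<sigma> using y_alg by (auto simp: grp_alg_def)
  then show ?thesis by (auto simp: y_def fun_eq_iff)
qed

text \<open>The combination \<open>Q\<close> with the Gram solution as coefficients commutes with
  every tensor power and has the traces \<open>t\<close>, so its difference from \<open>B\<close> is
  orthogonal to all permutation operators.\<close>

lemma commutant_perm_expansion:
  fixes B :: "(nat \<Rightarrow> 'm::finite) \<Rightarrow> (nat \<Rightarrow> 'm) \<Rightarrow> complex"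
  assumes comm: "\<And>U. unitary_mat U \<Longrightarrow> commutes_tensor p B U"
    and t: "t \<in> grp_alg p"
    and B: "\<And>\<tau>. \<tau> \<in> sym_grp p \<Longrightarrow> (\<Sum>L\<in>tuples p. B L (L \<circ> \<tau>)) = complex_of_real (t \<tau>)"
    and LK: "L \<in> tuples p" "K \<in> tuples p"
  shows "B L K = (\<Sum>\<sigma>\<in>sym_grp p. complex_of_real (conv p t (Wg CARD('m) p) \<sigma>) * of_bool (K = L \<circ> \<sigma>))"
proof -
  define c where "c = conv p t (Wg CARD('m) p)"
  define Q where "Q L K = (\<Sum>\<sigma>\<in>sym_grp p. complex_of_real (c \<sigma>) * of_bool (K = L \<circ> \<sigma>))" for L K :: "nat \<Rightarrow> 'm"
  have Q_comm: "commutes_tensor p Q A" for A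
    unfolding commutes_tensor_def
  proof (intro ballI)
    fix K L :: "nat \<Rightarrow> 'm" assume K: "K \<in> tuples p" and L: "L \<in> tuples p"
    have "(\<Sum>M\<in>tuples p. Q K M * tensor_power p A M L) = (\<Sum>\<sigma>\<in>sym_grp p. of_real (c \<sigma>) * tensor_power p A (K \<circ> \<sigma>) L)"
      unfolding Q_def sum_distrib_right
    proof (subst sum.swap, rule sum.cong[OF refl])
      fix \<sigma> assume \<sigma>: "\<sigma> \<in> sym_grp p"
      have "(\<Sum>M\<in>tuples p. of_real (c \<sigma>) * of_bool (M = K \<circ> \<sigma>) * tensor_power p A M L)
          = (\<Sum>M\<in>tuples p. if M = K \<circ> \<sigma> then of_real (c \<sigma>) * tensor_power p A (K \<circ> \<sigma>) L else 0)"
        by (intro sum.cong) auto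
      then show "(\<Sum>M\<in>tuples p. of_real (c \<sigma>) * of_bool (M = K \<circ> \<sigma>) * tensor_power p A M L)
          = of_real (c \<sigma>) * tensor_power p A (K \<circ> \<sigma>) L"
        using K \<sigma> by simp
    qed
    also have "\<dots> = (\<Sum>\<sigma>\<in>sym_grp p. of_real (c \<sigma>) * tensor_power p A K (L \<circ> inv \<sigma>))"
      by (intro sum.cong refl) (simp only: tensor_power_comp)
    also have "\<dots> = (\<Sum>M\<in>tuples p. tensor_power p A K M * Q M L)"
      unfolding Q_def sum_distrib_left
    proof (rule trans[OF sum.cong[OF refl] sum.swap])
      fix \<sigma> assume \<sigma>: "\<sigma> \<in> sym_grp p"
      have iff: "L = M \<circ> \<sigma> \<longleftrightarrow> M = L \<circ> inv \<sigma>" for M :: "nat \<Rightarrow> 'm"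
        using \<sigma> by auto
      have "(\<Sum>M\<in>tuples p. tensor_power p A K M * (of_real (c \<sigma>) * of_bool (L = M \<circ> \<sigma>)))
          = (\<Sum>M\<in>tuples p. if M = L \<circ> inv \<sigma> then of_real (c \<sigma>) * tensor_power p A K (L \<circ> inv \<sigma>) else 0)"
        by (intro sum.cong refl) (simp add: iff)
      then show "of_real (c \<sigma>) * tensor_power p A K (L \<circ> inv \<sigma>)
          = (\<Sum>M\<in>tuples p. tensor_power p A K M * (of_real (c \<sigma>) * of_bool (L = M \<circ> \<sigma>)))"
        using L \<sigma> by simp
    qed
    finally show "(\<Sum>M\<in>tuples p. Q K M * tensor_power p A M L) = (\<Sum>M\<in>tuples p. tensor_power p A K M * Q M L)" .
  qed
  have Q_trace: "(\<Sum>L\<in>tuples p. Q L (L \<circ> \<tau>)) = of_real (t \<tau>)" if \<tau>: "\<tau> \<in> sym_grp p" for \<tau>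
  proof -
    have "(\<Sum>L\<in>tuples p. Q L (L \<circ> \<tau>))
        = (\<Sum>\<sigma>\<in>sym_grp p. of_real (c \<sigma>) * (\<Sum>L\<in>tuples p. of_bool (L \<circ> \<sigma> = (L :: nat \<Rightarrow> 'm) \<circ> \<tau>)))"
      unfolding Q_def sum_distrib_left by (subst sum.swap) (simp only: eq_commute[of "_ \<circ> \<tau>"])
    also have "\<dots> = of_real (conv p c (cycle_weight CARD('m) p) \<tau>)"
      unfolding conv_def using \<tau>
      by (auto simp: sum_of_bool_comp_eq cycle_weight_def num_cycles_inv_comp simp del: sum_of_bool_eq intro!: sum.cong)
    also have "\<dots> = of_real (t \<tau>)"
      unfolding c_def using gram_solution[OF t B] by simp
    finally show ?thesis .
  qed
  have "B L K - Q L K = 0"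
  proof (rule commutes_tensor_orthogonal_zero[of p "\<lambda>L K. B L K - Q L K"])
    fix U :: "complex^'m^'m" assume "unitary_mat U"
    then show "commutes_tensor p (\<lambda>L K. B L K - Q L K) U"
      using comm[of U] Q_comm[of U]
      by (simp add: commutes_tensor_def algebra_simps sum_subtractf)
  qed (use LK B Q_trace in \<open>auto simp: sum_subtractf\<close>)
  then show ?thesis by (simp add: Q_def c_def)
qed


section \<open>Moments of Haar isometries\<close>

text \<open>The matrix entries of \<open>V\<^bsup>\<otimes>p\<^esup> P\<^sub>g (V\<^sup>*)\<^bsup>\<otimes>p\<^esup>\<close>, where \<open>P\<^sub>g\<close> permutes the tensor factors.\<close>

definition perm_moment ::
    "nat \<Rightarrow> (nat \<Rightarrow> nat) \<Rightarrow> complex^'d::finite^'m \<Rightarrow> (nat \<Rightarrow> 'm) \<Rightarrow> (nat \<Rightarrow> 'm) \<Rightarrow> complex" where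
  "perm_moment p g V L K = (\<Sum>I\<in>tuples p. tensor_power p V L (I \<circ> g) * cnj (tensor_power p V K I))"

text \<open>The tensor power of \<open>U\<close> on the right cancels against the adjoint of
  \<open>U\<close> inside the moment of U V. After integration, left invariance turns this identity
  into commutation with \<open>U\<close>.\<close>

lemma perm_moment_unitary:
  fixes V :: "complex^'d::finite^'m::finite"
  assumes U: "unitary_mat U"
  shows "(\<Sum>M\<in>tuples p. perm_moment p g (U ** V) K M * tensor_power p U M L)
    = (\<Sum>M\<in>tuples p. tensor_power p U K M * perm_moment p g V M L)"
proof -
  let ?T = "tensor_power p"
  have V: "adjoint_mat U ** (U ** V) = V"
    using U by (simp add: matrix_mul_assoc unitary_mat_def)
  have "(\<Sum>M\<in>tuples p. perm_moment p g (U ** V) K M * ?T U M L)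
      = (\<Sum>I\<in>tuples p. ?T (U ** V) K (I \<circ> g) * (\<Sum>M\<in>tuples p. cnj (?T (U ** V) M I) * ?T U M L))"
    unfolding perm_moment_def sum_distrib_left sum_distrib_right
    by (subst sum.swap) (simp only: mult.assoc)
  also have "\<dots> = (\<Sum>I\<in>tuples p. ?T (U ** V) K (I \<circ> g) * cnj (?T V L I))"
  proof (rule sum.cong[OF refl])
    fix I :: "nat \<Rightarrow> 'd"
    have "?T V L I = (\<Sum>M\<in>tuples p. cnj (?T U M L) * ?T (U ** V) M I)"
      using tensor_power_mult[of p "adjoint_mat U" "U ** V" L I] by (simp add: V tensor_power_adjoint)
    then show "?T (U ** V) K (I \<circ> g) * (\<Sum>M\<in>tuples p. cnj (?T (U ** V) M I) * ?T U M L)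
        = ?T (U ** V) K (I \<circ> g) * cnj (?T V L I)"
      by (simp add: mult.commute)
  qed
  also have "\<dots> = (\<Sum>M\<in>tuples p. ?T U K M * perm_moment p g V M L)"
    unfolding perm_moment_def tensor_power_mult sum_distrib_left sum_distrib_right
    by (subst sum.swap) (simp only: mult.assoc)
  finally show ?thesis .
qed

text \<open>Cyclicity of the trace brings the adjoint of V next to V, and the isometry property
  leaves permutation operators on d-dimensional factors. The value is the same for all isometries,
  hence also for the expectation.\<close>

lemma perm_moment_trace:
  fixes V :: "complex^'d::finite^'m::finite"
  assumes V: "isometry_mat V" and g: "g \<in> sym_grp p" and \<tau>: "\<tau> \<in> sym_grp p"
  shows "(\<Sum>L\<in>tuples p. perm_moment p g V L (L \<circ> \<tau>)) = of_nat (CARD('d) ^ num_cycles p (\<tau> \<circ> g))"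
proof -
  let ?T = "tensor_power p"
  have "(\<Sum>L\<in>tuples p. perm_moment p g V L (L \<circ> \<tau>))
      = (\<Sum>I\<in>tuples p. \<Sum>L\<in>tuples p. ?T (adjoint_mat V) (I \<circ> inv \<tau>) L * ?T V L (I \<circ> g))"
    unfolding perm_moment_def tensor_power_comp[OF \<tau>]
    by (subst sum.swap) (simp add: tensor_power_adjoint mult.commute)
  also have "\<dots> = (\<Sum>I\<in>tuples p. of_bool (I \<circ> inv \<tau> = (I :: nat \<Rightarrow> 'd) \<circ> g))"
    using V g \<tau> by (intro sum.cong refl)
      (simp only: tensor_power_mult[symmetric] isometry_mat_def tensor_power_mat_1 tuples_comp sym_grp_simps)
  also have "\<dots> = (\<Sum>I\<in>tuples p. of_bool ((I :: nat \<Rightarrow> 'd) \<circ> g = I \<circ> inv \<tau>))"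
    by (simp only: eq_commute)
  also have "\<dots> = of_nat (CARD('d) ^ num_cycles p (g \<circ> inv (inv \<tau>)))"
    using sum_of_bool_comp_eq[OF g sym_grp_simps(1)[OF \<tau>], where 'a = 'd and 'b = complex] .
  finally show ?thesis using g \<tau> by (simp add: num_cycles_comp_commute)
qed

text \<open>Each column is a unit vector. The bound makes all moments integrable.\<close>

lemma isometry_entry_le_1:
  assumes "isometry_mat V"
  shows "cmod (V $ a $ i) \<le> 1"
proof -
  have "(\<Sum>l\<in>UNIV. cnj (V $ l $ i) * V $ l $ i) = 1"
    using assms by (simp add: isometry_mat_def adjoint_mat_def matrix_matrix_mult_def mat_def vec_eq_iff)
  then have "complex_of_real (\<Sum>l\<in>UNIV. (cmod (V $ l $ i))\<^sup>2) = 1"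
    by (simp add: complex_norm_square mult.commute del: of_real_power)
  then have "(\<Sum>l\<in>UNIV. (cmod (V $ l $ i))\<^sup>2) = 1"
    by (simp only: of_real_eq_1_iff)
  moreover have "(cmod (V $ a $ i))\<^sup>2 \<le> (\<Sum>l\<in>UNIV. (cmod (V $ l $ i))\<^sup>2)"
    by (rule member_le_sum) auto
  ultimately show ?thesis
    by (metis norm_ge_zero one_power2 power2_le_imp_le zero_le_one)
qed

lemma isometry_tensor_power_le_1:
  assumes "isometry_mat V"
  shows "cmod (tensor_power p V K L) \<le> 1"
  unfolding tensor_power_def prod_norm[symmetric]
  by (intro prod_le_1) (simp add: isometry_entry_le_1[OF assms])

lemma borel_measurable_mult_left:
  "(\<lambda>V :: complex^'d::finite^'m::finite. U ** V) \<in> borel_measurable borel"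
  unfolding matrix_matrix_mult_def
  by (intro borel_measurable_continuous_onI continuous_intros)

lemma integrable_perm_moment:
  fixes \<mu> :: "(complex^'d::finite^'m::finite) measure"
  assumes \<mu>: "haar_isometry_law \<mu>"
  shows "integrable \<mu> (\<lambda>V. perm_moment p g V L K)"
  unfolding perm_moment_def
proof (intro Bochner_Integration.integrable_sum)
  fix I :: "nat \<Rightarrow> 'd"
  interpret prob_space \<mu> using \<mu> by (simp add: haar_isometry_law_def)
  have sets: "sets \<mu> = sets borel" using \<mu> by (simp add: haar_isometry_law_def)
  have "AE V in \<mu>. isometry_mat V" using \<mu> by (simp add: haar_isometry_law_def)
  then have "AE V in \<mu>. cmod (tensor_power p V L (I \<circ> g) * cnj (tensor_power p V K I)) \<le> 1"
    by eventually_elim (auto simp: norm_mult intro!: mult_le_one isometry_tensor_power_le_1)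
  then show "integrable \<mu> (\<lambda>V. tensor_power p V L (I \<circ> g) * cnj (tensor_power p V K I))"
  proof (rule integrable_const_bound)
    show "(\<lambda>V. tensor_power p V L (I \<circ> g) * cnj (tensor_power p V K I)) \<in> borel_measurable \<mu>"
      unfolding measurable_cong_sets[OF sets refl] tensor_power_def
      by (intro borel_measurable_continuous_onI continuous_intros)
  qed
qed

lemma haar_isometry_moment:
  fixes \<mu> :: "(complex^'d::finite^'m::finite) measure"
  assumes \<mu>: "haar_isometry_law \<mu>" and g: "g \<in> sym_grp p"
    and LK: "L \<in> tuples p" "K \<in> tuples p"
  defines "t \<equiv> \<lambda>\<tau>. if \<tau> \<in> sym_grp p then real CARD('d) ^ num_cycles p (\<tau> \<circ> g) else 0"
  shows "(\<integral>V. perm_moment p g V L K \<partial>\<mu>)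
    = (\<Sum>\<sigma>\<in>sym_grp p. complex_of_real (conv p t (Wg CARD('m) p) \<sigma>) * of_bool (K = L \<circ> \<sigma>))"
proof (rule commutant_perm_expansion[OF _ _ _ LK])
  interpret prob_space \<mu> using \<mu> by (simp add: haar_isometry_law_def)
  have sets: "sets \<mu> = sets borel" using \<mu> by (simp add: haar_isometry_law_def)
  note int [simp] = integrable_perm_moment[OF \<mu>]
  show "t \<in> grp_alg p" by (simp add: t_def grp_alg_def)
  show "(\<Sum>L\<in>tuples p. \<integral>V. perm_moment p g V L (L \<circ> \<tau>) \<partial>\<mu>) = complex_of_real (t \<tau>)"
    if \<tau>: "\<tau> \<in> sym_grp p" for \<tau>
  proof -
    have "(\<Sum>L\<in>tuples p. \<integral>V. perm_moment p g V L (L \<circ> \<tau>) \<partial>\<mu>)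
        = (\<integral>V. (\<Sum>L\<in>tuples p. perm_moment p g V L (L \<circ> \<tau>)) \<partial>\<mu>)"
      by (simp add: Bochner_Integration.integral_sum)
    also have "\<dots> = (\<integral>V. complex_of_real (t \<tau>) \<partial>\<mu>)"
    proof (rule integral_cong_AE)
      have "AE V in \<mu>. isometry_mat V" using \<mu> by (simp add: haar_isometry_law_def)
      then show "AE V in \<mu>. (\<Sum>L\<in>tuples p. perm_moment p g V L (L \<circ> \<tau>)) = complex_of_real (t \<tau>)"
        by eventually_elim (simp add: perm_moment_trace g \<tau> t_def)
      show "(\<lambda>V. \<Sum>L\<in>tuples p. perm_moment p g V L (L \<circ> \<tau>)) \<in> borel_measurable \<mu>"
        by (intro borel_measurable_integrable Bochner_Integration.integrable_sum int)
    qed simp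
    finally show ?thesis by (simp add: prob_space)
  qed
  fix U :: "complex^'m^'m" assume U: "unitary_mat U"
  then have inv: "distr \<mu> borel (\<lambda>V. U ** V) = \<mu>"
    using \<mu> by (simp add: haar_isometry_law_def)
  have meas: "(\<lambda>V :: complex^'d^'m. perm_moment p g V L K) \<in> borel_measurable borel"
    for L K using borel_measurable_integrable[OF int] sets by (simp add: measurable_cong_sets[OF sets refl])
  have meas_U: "(\<lambda>V. U ** V) \<in> measurable \<mu> borel"
    using borel_measurable_mult_left by (simp add: measurable_cong_sets[OF sets refl])
  have int_U: "integrable \<mu> (\<lambda>V. perm_moment p g (U ** V) L K)" for L K
    using integrable_distr_eq[OF meas_U meas, of L K] int by (simp add: inv)
  have eq_U: "(\<integral>V. perm_moment p g (U ** V) L K \<partial>\<mu>) = (\<integral>V. perm_moment p g V L K \<partial>\<mu>)" for L K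
    using integral_distr[OF meas_U meas, of L K] by (simp add: inv)
  show "commutes_tensor p (\<lambda>L K. \<integral>V. perm_moment p g V L K \<partial>\<mu>) U"
    unfolding commutes_tensor_def
  proof (intro ballI)
    fix K L :: "nat \<Rightarrow> 'm"
    have "(\<Sum>M\<in>tuples p. (\<integral>V. perm_moment p g V K M \<partial>\<mu>) * tensor_power p U M L)
        = (\<integral>V. (\<Sum>M\<in>tuples p. perm_moment p g (U ** V) K M * tensor_power p U M L) \<partial>\<mu>)"
      by (simp add: Bochner_Integration.integral_sum int_U eq_U)
    also have "\<dots> = (\<Sum>M\<in>tuples p. tensor_power p U K M * (\<integral>V. perm_moment p g V M L \<partial>\<mu>))"
      by (simp add: perm_moment_unitary[OF U] Bochner_Integration.integral_sum)
    finally show "(\<Sum>M\<in>tuples p. (\<integral>V. perm_moment p g V K M \<partial>\<mu>) * tensor_power p U M L)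
        = (\<Sum>M\<in>tuples p. tensor_power p U K M * (\<integral>V. perm_moment p g V M L \<partial>\<mu>))" .
  qed
qed

section \<open>The full cycle and traces of matrix powers\<close>

lemma full_cycle_sym_grp [simp]: "full_cycle p \<in> sym_grp p"
  using cycle_permutes[of "rev [1..<Suc p]"]
  by (simp add: full_cycle_def sym_grp_def atLeastLessThanSuc_atLeastAtMost del: upt_Suc)

text \<open>The full cycle descends, so its inverse is the cyclic successor, the order in which
  indices follow each other in the trace of a product.\<close>

lemma inv_full_cycle:
  assumes "l \<in> {1..p}"
  shows "inv (full_cycle p) l = (if l = p then 1 else Suc l)"
proof -
  let ?cs = "rev [1..<Suc p]"
  have "map (cycle_of_list ?cs ^^ 1) ?cs = rotate 1 ?cs"
    by (rule cyclic_rotation) simp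
  then have map: "map (full_cycle p) ?cs = rotate 1 ?cs" by (simp add: full_cycle_def)
  \<comment> \<open>With positions counted from 0, the list holds p - i at position i; rotation by
    one advances the position modulo p.\<close>
  have nth: "?cs ! i = p - i" if "i < p" for i
    using that by (simp add: rev_nth del: upt_Suc)
  have step: "full_cycle p (p - i) = p - (Suc i mod p)" if "i < p" for i
  proof -
    have "map (full_cycle p) ?cs ! i = full_cycle p (p - i)"
      using that nth[OF that] by (simp del: upt_Suc)
    moreover have "rotate 1 ?cs ! i = p - (Suc i mod p)"
      using that nth[of "Suc i mod p"] by (subst nth_rotate) (simp_all del: upt_Suc)
    ultimately show ?thesis by (simp only: map)
  qed
  let ?m = "if l = p then 1 else Suc l"
  have "full_cycle p ?m = l"
    using step[of "p - ?m"] assms by (auto simp: mod_if split: if_splits)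
  moreover have "bij (full_cycle p)"
    using full_cycle_sym_grp[of p] unfolding sym_grp_def by (auto intro: permutes_bij)
  ultimately show ?thesis by (intro inv_f_eq bij_is_inj)
qed

lemma sum_tuples_Suc:
  fixes f :: "(nat \<Rightarrow> 'a::finite) \<Rightarrow> 'b::comm_monoid_add"
  shows "(\<Sum>I\<in>tuples (Suc p). f I) = (\<Sum>I\<in>tuples p. \<Sum>k\<in>UNIV. f (I(Suc p := k)))"
proof -
  let ?u = "\<lambda>(k, I :: nat \<Rightarrow> 'a). I(Suc p := k)"
  have inj: "inj_on ?u (UNIV \<times> tuples p)"
    using inj_combinator[of "Suc p" "{1..p}" "\<lambda>_. UNIV :: 'a set"] by (simp add: tuples_def)
  have image: "tuples (Suc p) = ?u ` (UNIV \<times> tuples p)"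
    by (simp add: tuples_def PiE_insert_eq atLeastAtMostSuc_conv)
  have "(\<Sum>I\<in>tuples (Suc p). f I) = (\<Sum>(k, I)\<in>UNIV \<times> tuples p. f (I(Suc p := k)))"
    unfolding image sum.reindex[OF inj] by (simp add: case_prod_unfold)
  also have "\<dots> = (\<Sum>I\<in>tuples p. \<Sum>k\<in>UNIV. f (I(Suc p := k)))"
    by (subst sum.swap) (simp add: sum.cartesian_product)
  finally show ?thesis .
qed

lemma mat_power_Suc_right: "mat_power A (Suc p) = mat_power A p ** A"
  by (induction p) (simp_all add: mat_power_def matrix_mul_assoc)

text \<open>The tuple records the starting points of the p + 1 edges of a path, while its end j
  stays outside. The induction extends the path at its end, so a factor is split off on the
  right.\<close>

lemma mat_power_entry:
  fixes M :: "complex^'d^'d::finite"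
  shows "mat_power M (Suc p) $ i $ j
    = (\<Sum>I\<in>tuples (Suc p). of_bool (I 1 = i) * (\<Prod>l\<in>{1..p}. M $ I l $ I (Suc l)) * M $ I (Suc p) $ j)"
proof (induction p arbitrary: j)
  case 0
  have "(\<Sum>I\<in>tuples (Suc 0). of_bool (I 1 = i) * (\<Prod>l\<in>{1..0}. M $ I l $ I (Suc l)) * M $ I (Suc 0) $ j)
      = (\<Sum>k\<in>UNIV. if k = i then M $ i $ j else 0)"
    by (subst sum_tuples_Suc) (auto simp: tuples_def intro!: sum.cong)
  then show ?case by (simp add: mat_power_def)
next
  case (Suc p)
  have "mat_power M (Suc (Suc p)) $ i $ j = (\<Sum>k\<in>UNIV. mat_power M (Suc p) $ i $ k * M $ k $ j)"
    by (subst mat_power_Suc_right) (simp add: matrix_matrix_mult_def)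
  also have "\<dots> = (\<Sum>I\<in>tuples (Suc p). \<Sum>k\<in>UNIV.
      of_bool (I 1 = i) * (\<Prod>l\<in>{1..p}. M $ I l $ I (Suc l)) * M $ I (Suc p) $ k * M $ k $ j)"
    unfolding Suc.IH sum_distrib_right by (rule sum.swap)
  also have "\<dots> = (\<Sum>I\<in>tuples (Suc (Suc p)). of_bool (I 1 = i)
      * (\<Prod>l\<in>{1..Suc p}. M $ I l $ I (Suc l)) * M $ I (Suc (Suc p)) $ j)"
    unfolding sum_tuples_Suc[of _ "Suc p"] by (intro sum.cong refl) simp
  finally show ?case .
qed

text \<open>Summing over the diagonal closes each path at its first vertex, so that position p is
  followed by position 1.\<close>

lemma trace_mat_power:
  fixes M :: "complex^'d^'d::finite"
  assumes "p \<ge> 1"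
  shows "trace (mat_power M p) = (\<Sum>I\<in>tuples p. tensor_power p M I (I \<circ> inv (full_cycle p)))"
proof -
  obtain q where p: "p = Suc q" using assms by (cases p) auto
  have "trace (mat_power M p) = (\<Sum>I\<in>tuples p. \<Sum>i\<in>UNIV.
      of_bool (I 1 = i) * (\<Prod>l\<in>{1..q}. M $ I l $ I (Suc l)) * M $ I p $ i)"
    unfolding trace_def p mat_power_entry by (rule sum.swap)
  also have "\<dots> = (\<Sum>I\<in>tuples p. tensor_power p M I (I \<circ> inv (full_cycle p)))"
  proof (rule sum.cong[OF refl])
    fix I :: "nat \<Rightarrow> 'd"
    have "(\<Sum>i\<in>UNIV. of_bool (I 1 = i) * (\<Prod>l\<in>{1..q}. M $ I l $ I (Suc l)) * M $ I p $ i)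
        = (\<Sum>i\<in>UNIV. if i = I 1 then (\<Prod>l\<in>{1..q}. M $ I l $ I (Suc l)) * M $ I p $ I 1 else 0)"
      by (intro sum.cong) auto
    also have "\<dots> = (\<Prod>l\<in>{1..q}. M $ I l $ I (Suc l)) * M $ I p $ I 1" by simp
    also have "\<dots> = (\<Prod>l\<in>{1..q}. M $ I l $ I (inv (full_cycle p) l)) * M $ I p $ I (inv (full_cycle p) p)"
      using p by (simp add: inv_full_cycle)
    also have "\<dots> = tensor_power p M I (I \<circ> inv (full_cycle p))"
      by (simp add: tensor_power_def p)
    finally show "(\<Sum>i\<in>UNIV. of_bool (I 1 = i) * (\<Prod>l\<in>{1..q}. M $ I l $ I (Suc l)) * M $ I p $ i)
        = tensor_power p M I (I \<circ> inv (full_cycle p))" .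
  qed
  finally show ?thesis .
qed

section \<open>Pairing the projection with permutation operators\<close>

lemma sum_tuples_prod:
  fixes f :: "(nat \<Rightarrow> 'a::finite) \<Rightarrow> (nat \<Rightarrow> 'b::finite) \<Rightarrow> 'c::comm_monoid_add"
  shows "(\<Sum>L\<in>tuples p. f (\<lambda>l\<in>{1..p}. fst (L l)) (\<lambda>l\<in>{1..p}. snd (L l)))
    = (\<Sum>I\<in>tuples p. \<Sum>J\<in>tuples p. f I J)"
proof -
  let ?fst = "\<lambda>L. \<lambda>l\<in>{1..p}. fst (L l)" and ?snd = "\<lambda>L. \<lambda>l\<in>{1..p}. snd (L l)"
  let ?pair = "\<lambda>I J. \<lambda>l\<in>{1..p}. (I l, J l)"
  have tuples: "?fst L \<in> tuples p" "?snd L \<in> tuples p" "?pair I J \<in> tuples p"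
    for L :: "nat \<Rightarrow> 'a \<times> 'b" and I :: "nat \<Rightarrow> 'a" and J :: "nat \<Rightarrow> 'b"
    by (simp_all add: tuples_def)
  have pair: "?pair (?fst L) (?snd L) = L" if "L \<in> tuples p" for L :: "nat \<Rightarrow> 'a \<times> 'b"
    using that by (intro tuples_eqI[OF tuples(3)]) simp_all
  have proj: "?fst (?pair I J) = I" "?snd (?pair I J) = J" if "I \<in> tuples p" "J \<in> tuples p"
    for I :: "nat \<Rightarrow> 'a" and J :: "nat \<Rightarrow> 'b"
  proof -
    show "?fst (?pair I J) = I" using that(1) by (intro tuples_eqI[OF tuples(1)]) simp_all
    show "?snd (?pair I J) = J" using that(2) by (intro tuples_eqI[OF tuples(2)]) simp_all
  qed
  have "(\<Sum>L\<in>tuples p. f (?fst L) (?snd L)) = (\<Sum>(I, J)\<in>tuples p \<times> tuples p. f I J)"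
  proof (rule sum.reindex_bij_witness[of _ "\<lambda>(I, J). ?pair I J" "\<lambda>L. (?fst L, ?snd L)"])
    fix x :: "(nat \<Rightarrow> 'a) \<times> (nat \<Rightarrow> 'b)" assume "x \<in> tuples p \<times> tuples p"
    then obtain I J where "x = (I, J)" "I \<in> tuples p" "J \<in> tuples p" by blast
    then show "(?fst ((\<lambda>(I, J). ?pair I J) x), ?snd ((\<lambda>(I, J). ?pair I J) x)) = x"
      by (simp only: case_prod_conv proj)
    show "(\<lambda>(I, J). ?pair I J) x \<in> tuples p"
      using \<open>x = (I, J)\<close> by (simp only: case_prod_conv tuples)
  qed (simp_all only: case_prod_conv pair tuples mem_Sigma_iff)
  then show ?thesis by (simp add: sum.cartesian_product)
qed

text \<open>The trace factors over the two tensor legs. Permutations fix the tensor power of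
  \<open>v\<close>, so its leg contributes 1 by normalization; the other leg counts the tuples fixed
  by \<sigma>.\<close>

lemma sum_tensor_power_effect:
  fixes v :: "complex^'k::finite"
  assumes v: "(\<Sum>a\<in>UNIV. v $ a * cnj (v $ a)) = 1" and \<sigma>: "\<sigma> \<in> sym_grp p"
  shows "(\<Sum>L\<in>tuples p. tensor_power p (tensor_mat (rank_one v) (mat 1 :: complex^'n^'n::finite)) (L \<circ> \<sigma>) L)
    = of_nat (CARD('n) ^ num_cycles p \<sigma>)"
proof -
  let ?A = "tensor_mat (rank_one v) (mat 1 :: complex^'n^'n)"
  have eq: "tensor_power p ?A (L \<circ> \<sigma>) L
      = (\<Prod>l\<in>{1..p}. v $ (\<lambda>l\<in>{1..p}. fst (L l)) l * cnj (v $ (\<lambda>l\<in>{1..p}. fst (L l)) l))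
        * of_bool ((\<lambda>l\<in>{1..p}. snd (L l)) \<circ> \<sigma> = (\<lambda>l\<in>{1..p}. snd (L l)))"
    if "L \<in> tuples p" for L
  proof -
    have \<sigma>_in: "\<sigma> l \<in> {1..p} \<longleftrightarrow> l \<in> {1..p}" for l
      using \<sigma> permutes_in_image[of \<sigma> "{1..p}"] by (simp add: sym_grp_def)
    let ?J = "\<lambda>l\<in>{1..p}. snd (L l)"
    have J: "?J \<in> tuples p" by (simp add: tuples_def)
    have J\<sigma>: "?J \<circ> \<sigma> \<in> tuples p" using J \<sigma> by (rule tuples_comp)
    have "tensor_power p ?A (L \<circ> \<sigma>) L = (\<Prod>l\<in>{1..p}. v $ fst (L (\<sigma> l)))
        * (\<Prod>l\<in>{1..p}. cnj (v $ fst (L l))) * (\<Prod>l\<in>{1..p}. of_bool (snd (L (\<sigma> l)) = snd (L l)))"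
      by (simp add: tensor_power_def tensor_mat_def rank_one_def mat_def of_bool_def prod.distrib mult.assoc)
    also have "(\<Prod>l\<in>{1..p}. v $ fst (L (\<sigma> l))) = (\<Prod>l\<in>{1..p}. v $ fst (L l))"
      using prod_sym_grp[OF \<sigma>, of "\<lambda>l. v $ fst (L l)"] .
    also have "(\<Prod>l\<in>{1..p}. of_bool (snd (L (\<sigma> l)) = snd (L l))) = (of_bool (?J \<circ> \<sigma> = ?J) :: complex)"
    proof -
      have "(\<forall>l\<in>{1..p}. snd (L (\<sigma> l)) = snd (L l)) \<longleftrightarrow> (\<forall>l\<in>{1..p}. (?J \<circ> \<sigma>) l = ?J l)"
        using \<sigma>_in by (intro ball_cong) (simp_all only: comp_apply restrict_apply if_True)
      also have "\<dots> \<longleftrightarrow> ?J \<circ> \<sigma> = ?J"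
        by (rule tuples_eq_iff[OF J\<sigma> J])
      finally show ?thesis by (simp only: prod_of_bool[OF finite_atLeastAtMost])
    qed
    finally show ?thesis by (simp add: prod.distrib o_def)
  qed
  have "(\<Sum>L\<in>tuples p. tensor_power p ?A (L \<circ> \<sigma>) L)
      = (\<Sum>L\<in>(tuples p :: (nat \<Rightarrow> 'k \<times> 'n) set). (\<Prod>l\<in>{1..p}. v $ (\<lambda>l\<in>{1..p}. fst (L l)) l * cnj (v $ (\<lambda>l\<in>{1..p}. fst (L l)) l))
        * of_bool ((\<lambda>l\<in>{1..p}. snd (L l)) \<circ> \<sigma> = (\<lambda>l\<in>{1..p}. snd (L l))))"
    by (rule sum.cong[OF refl]) (rule eq)
  also have "\<dots> = (\<Sum>I\<in>tuples p. \<Sum>J\<in>tuples p. (\<Prod>l\<in>{1..p}. v $ I l * cnj (v $ I l)) * of_bool (J \<circ> \<sigma> = (J :: nat \<Rightarrow> 'n)))"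
    by (rule sum_tuples_prod[of "\<lambda>I J. (\<Prod>l\<in>{1..p}. v $ I l * cnj (v $ I l)) * of_bool (J \<circ> \<sigma> = J)"])
  also have "\<dots> = (\<Sum>I\<in>tuples p. \<Prod>l\<in>{1..p}. v $ I l * cnj (v $ I l)) * (\<Sum>J\<in>tuples p. of_bool (J \<circ> \<sigma> = (J :: nat \<Rightarrow> 'n)))"
    by (simp only: sum_product)
  also have "(\<Sum>I\<in>tuples p. \<Prod>l\<in>{1..p}. v $ I l * cnj (v $ I l)) = 1"
    using prod_sum_PiE[of "{1..p}" "\<lambda>_. UNIV" "\<lambda>_ a. v $ a * cnj (v $ a)"] by (simp add: tuples_def v)
  also have "(\<Sum>J\<in>tuples p. of_bool (J \<circ> \<sigma> = (J :: nat \<Rightarrow> 'n))) = (of_nat (CARD('n) ^ num_cycles p \<sigma>) :: complex)"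
    using sum_of_bool_comp_eq[OF \<sigma> id_sym_grp, where 'a = 'n and 'b = complex] by (simp add: inv_id del: sum_of_bool_eq)
  finally show ?thesis by (simp add: o_def)
qed

section \<open>The expected trace of a power of the first effect\<close>

theorem proposition6p1:
  fixes P :: "'w measure"
    and V :: "'w \<Rightarrow> complex^'d::finite^('k::finite \<times> 'n::finite)"
    and e :: "nat \<Rightarrow> complex^'k"
    and p :: nat
  assumes "CARD('d) \<le> CARD('k) * CARD('n)"
    and "prob_space P"
    and "haar_isometry P V"
    and "orthonormal_basis e"
    and "p \<ge> 1"
  shows "prob_space.expectation P (\<lambda>\<omega>. trace (mat_power (povm_effect e (V \<omega>) 1) p)) =
    complex_of_real (\<Sum>\<alpha>\<in>sym_grp p. \<Sum>\<beta>\<in>sym_grp p.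
      real CARD('n) ^ num_cycles p \<alpha> *
      real CARD('d) ^ num_cycles p (\<beta> \<circ> inv (full_cycle p)) *
      Wg (CARD('k) * CARD('n)) p (inv \<alpha> \<circ> \<beta>))"
proof -
  define \<mu> where "\<mu> = distr P borel V"
  have V: "V \<in> borel_measurable P" and \<mu>: "haar_isometry_law \<mu>"
    using assms(3) by (auto simp: haar_isometry_def \<mu>_def)
  define g where "g = inv (full_cycle p)"
  have g: "g \<in> sym_grp p" by (simp add: g_def)
  define t where "t \<tau> = (if \<tau> \<in> sym_grp p then real CARD('d) ^ num_cycles p (\<tau> \<circ> g) else 0)" for \<tau>
  define w where "w = Wg (CARD('k) * CARD('n)) p"
  define A where "A = tensor_mat (rank_one (e 1)) (mat 1 :: complex^'n^'n)"
  have "(\<Sum>a\<in>UNIV. cnj (e 1 $ a) * e 1 $ a) = 1"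
    using assms(4) by (auto simp: orthonormal_basis_def dest!: bspec[of _ _ 1])
  then have e1: "(\<Sum>a\<in>UNIV. e 1 $ a * cnj (e 1 $ a)) = 1" by (simp add: mult.commute)
  \<comment> \<open>Cyclicity of the trace separates the deterministic projection \<open>A\<close>
    from the random moment.\<close>
  have trace: "trace (mat_power (povm_effect e X 1) p)
      = (\<Sum>L\<in>tuples p. \<Sum>K\<in>tuples p. tensor_power p A K L * perm_moment p g X L K)"
    for X :: "complex^'d^('k \<times> 'n)"
  proof -
    have "trace (mat_power (povm_effect e X 1) p)
        = (\<Sum>I\<in>tuples p. tensor_power p (adjoint_mat X ** A ** X) I (I \<circ> g))"
      unfolding trace_mat_power[OF assms(5)] povm_effect_def A_def g_def ..
    also have "\<dots> = (\<Sum>I\<in>tuples p. \<Sum>L\<in>tuples p. \<Sum>K\<in>tuples p.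
        tensor_power p A K L * (tensor_power p X L (I \<circ> g) * cnj (tensor_power p X K I)))"
      unfolding tensor_power_mult tensor_power_adjoint sum_distrib_right by (simp only: mult_ac)
    also have "\<dots> = (\<Sum>L\<in>tuples p. \<Sum>K\<in>tuples p. tensor_power p A K L * perm_moment p g X L K)"
      unfolding perm_moment_def sum_distrib_left
      by (subst sum.swap) (intro sum.cong refl sum.swap)
    finally show ?thesis .
  qed
  have sets: "sets \<mu> = sets borel" using \<mu> by (simp add: haar_isometry_law_def)
  have int: "integrable \<mu> (\<lambda>X. perm_moment p g X L K)" for L K
    by (rule integrable_perm_moment[OF \<mu>])
  have "(\<lambda>X. trace (mat_power (povm_effect e X 1) p)) \<in> borel_measurable \<mu>"
    unfolding trace
    by (intro borel_measurable_integrable Bochner_Integration.integrable_sum integrable_mult_right int)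
  then have "(\<lambda>X :: complex^'d^('k \<times> 'n). trace (mat_power (povm_effect e X 1) p)) \<in> borel_measurable borel"
    by (simp add: measurable_cong_sets[OF sets refl])
  then have "prob_space.expectation P (\<lambda>\<omega>. trace (mat_power (povm_effect e (V \<omega>) 1) p))
      = (\<integral>X. trace (mat_power (povm_effect e X 1) p) \<partial>\<mu>)"
    unfolding \<mu>_def by (simp add: integral_distr[OF V])
  also have "\<dots> = (\<Sum>L\<in>tuples p. \<Sum>K\<in>tuples p. tensor_power p A K L * (\<integral>X. perm_moment p g X L K \<partial>\<mu>))"
    unfolding trace by (simp add: Bochner_Integration.integral_sum int)
  also have "\<dots> = (\<Sum>L\<in>tuples p. \<Sum>K\<in>tuples p. \<Sum>\<sigma>\<in>sym_grp p.
      tensor_power p A K L * (complex_of_real (conv p t w \<sigma>) * of_bool (K = L \<circ> \<sigma>)))"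
    by (intro sum.cong refl)
      (simp only: haar_isometry_moment[OF \<mu> g] t_def[abs_def] w_def card_prod sum_distrib_left)
  also have "\<dots> = (\<Sum>L\<in>tuples p. \<Sum>\<sigma>\<in>sym_grp p. complex_of_real (conv p t w \<sigma>) * tensor_power p A (L \<circ> \<sigma>) L)"
  proof (rule sum.cong[OF refl], subst sum.swap, rule sum.cong[OF refl])
    fix L :: "nat \<Rightarrow> 'k \<times> 'n" and \<sigma> assume "L \<in> tuples p" "\<sigma> \<in> sym_grp p"
    moreover have "(\<Sum>K\<in>tuples p. tensor_power p A K L * (complex_of_real (conv p t w \<sigma>) * of_bool (K = L \<circ> \<sigma>)))
        = (\<Sum>K\<in>tuples p. if K = L \<circ> \<sigma> then complex_of_real (conv p t w \<sigma>) * tensor_power p A (L \<circ> \<sigma>) L else 0)"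
      by (intro sum.cong) auto
    ultimately show "(\<Sum>K\<in>tuples p. tensor_power p A K L * (complex_of_real (conv p t w \<sigma>) * of_bool (K = L \<circ> \<sigma>)))
        = complex_of_real (conv p t w \<sigma>) * tensor_power p A (L \<circ> \<sigma>) L" by simp
  qed
  also have "\<dots> = (\<Sum>\<sigma>\<in>sym_grp p. complex_of_real (conv p t w \<sigma>) * (\<Sum>L\<in>tuples p. tensor_power p A (L \<circ> \<sigma>) L))"
    unfolding sum_distrib_left by (rule sum.swap)
  also have "\<dots> = (\<Sum>\<sigma>\<in>sym_grp p. complex_of_real (conv p t w \<sigma>) * of_nat (CARD('n) ^ num_cycles p \<sigma>))"
    unfolding A_def by (intro sum.cong refl) (simp only: sum_tensor_power_effect[OF e1])
  also have "\<dots> = complex_of_real (\<Sum>\<alpha>\<in>sym_grp p. \<Sum>\<beta>\<in>sym_grp p.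
      real CARD('n) ^ num_cycles p \<alpha> * real CARD('d) ^ num_cycles p (\<beta> \<circ> g) * w (inv \<alpha> \<circ> \<beta>))"
  proof -
    have eq: "conv p t w \<alpha> * real CARD('n) ^ num_cycles p \<alpha> = (\<Sum>\<beta>\<in>sym_grp p.
        real CARD('n) ^ num_cycles p \<alpha> * real CARD('d) ^ num_cycles p (\<beta> \<circ> g) * w (inv \<alpha> \<circ> \<beta>))"
      if \<alpha>: "\<alpha> \<in> sym_grp p" for \<alpha>
    proof -
      \<comment> \<open>Convolution evaluates the Weingarten function at the inverse of the
        permutation in the formula; the symmetry \<open>star_Wg\<close> exchanges the two.\<close>
      have "w (inv \<beta> \<circ> \<alpha>) = w (inv \<alpha> \<circ> \<beta>)" if "\<beta> \<in> sym_grp p" for \<beta>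
        using fun_cong[OF star_Wg, of p "CARD('k) * CARD('n)" "inv \<alpha> \<circ> \<beta>"] \<alpha> that
        by (simp add: star_def w_def sym_grp_simps(6)[OF sym_grp_simps(1)])
      then show ?thesis
        using \<alpha> by (simp add: conv_def t_def sum_distrib_left sum_distrib_right mult_ac)
    qed
    have "(\<Sum>\<sigma>\<in>sym_grp p. complex_of_real (conv p t w \<sigma>) * of_nat (CARD('n) ^ num_cycles p \<sigma>))
        = complex_of_real (\<Sum>\<alpha>\<in>sym_grp p. conv p t w \<alpha> * real CARD('n) ^ num_cycles p \<alpha>)"
      by simp
    also have "\<dots> = complex_of_real (\<Sum>\<alpha>\<in>sym_grp p. \<Sum>\<beta>\<in>sym_grp p.
        real CARD('n) ^ num_cycles p \<alpha> * real CARD('d) ^ num_cycles p (\<beta> \<circ> g) * w (inv \<alpha> \<circ> \<beta>))"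
      by (rule arg_cong[where f = complex_of_real]) (rule sum.cong[OF refl], rule eq)
    finally show ?thesis .
  qed
  finally show ?thesis by (simp only: g_def w_def)
qed

end
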